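(* Let $m,n\ge 2$ be integers and let $(W_n,\pi_n)$ be the usual real representation of $\mathfrak{sl}(m,\mathbb{R})$ on the space of complex homogeneous polynomials of degree $n$ in $m$ variables, extended to $\mathfrak{gl}(m,\mathbb{R})$ by letting the center act as (nonzero) real multiples of the identity. Then the Lie algebra $\mathfrak{gl}(m,\mathbb{R})\ltimes W_n$, in which $W_n$ is an abelian ideal, admits an inner product with negative Ricci curvature.
   Context: Representation: $W_n=\mathcal{P}_n(\mathbb{C}^m)$ is regarded as a real vector space, and $X\in\mathfrak{sl}(m,\mathbb{R})$ acts by $(\pi_n(X)P)(z)=\frac{d}{dt}\big|_{t=0}P(e^{-tX}z)$. The center of $\mathfrak{gl}(m,\mathbb{R})=\mathbb{R}\,\mathrm{I}\oplus\mathfrak{sl}(m,\mathbb{R})$ acts through $\pi_n(\mathrm{I})=c\,\mathrm{Id}_{W_n}$ for a fixed real $c\neq0$ (e.g. $c=1$). Ricci curvature: an inner product $\langle\cdot,\cdot\rangle$ on a real finite-dimensional Lie algebra $\mathfrak{g}$ has negative Ricci curvature if the Ricci operator of the corresponding left-invariant Riemannian metric on a Lie group with Lie algebra $\mathfrak{g}$ is negative definite. Explicitly, the Ricci operator is $\operatorname{Ric}=M-\tfrac12 B-S(\operatorname{ad}H)$, where $H\in\mathfrak{g}$ is defined by $\langle H,X\rangle=\operatorname{tr}\operatorname{ad}X$ for all $X$, $S(A)=\tfrac12(A+A^t)$, $B$ is the symmetric operator with $\langle BX,X\rangle=\operatorname{tr}(\operatorname{ad}X)^2$, and $M$ is the symmetric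 operator with $\langle MX,X\rangle=-\tfrac12\sum_{i,j}\langle[X,X_i],X_j\rangle^2+\tfrac14\sum_{i,j}\langle[X_i,X_j],X\rangle^2$ for any orthonormal basis $\{X_i\}$ of $\mathfrak{g}$. *)

theory Defs
  imports "HOL-Analysis.Analysis" "HOL-Library.Function_Algebras"
begin

section \<open>Metric Lie algebras and their Ricci operator\<close>

text \<open>
  Lie algebras are carried by a subspace of an ambient real vector space; the bracket and the inner
  product are only constrained on that subspace.
\<close>

locale real_lie_algebra =
  fixes L :: "'a::real_vector set"
    and bracket :: "'a \<Rightarrow> 'a \<Rightarrow> 'a"
  assumes subspace_L: "subspace L"
    and finite_dimensional: "\<exists>B. finite B \<and> L = span B"
    and bracket_closed: "x \<in> L \<Longrightarrow> y \<in> L \<Longrightarrow> bracket x y \<in> L"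
    and bracket_add_left:
      "x \<in> L \<Longrightarrow> y \<in> L \<Longrightarrow> z \<in> L \<Longrightarrow> bracket (x + y) z = bracket x z + bracket y z"
    and bracket_add_right:
      "x \<in> L \<Longrightarrow> y \<in> L \<Longrightarrow> z \<in> L \<Longrightarrow> bracket x (y + z) = bracket x y + bracket x z"
    and bracket_scale_left: "x \<in> L \<Longrightarrow> y \<in> L \<Longrightarrow> bracket (r *\<^sub>R x) y = r *\<^sub>R bracket x y"
    and bracket_scale_right: "x \<in> L \<Longrightarrow> y \<in> L \<Longrightarrow> bracket x (r *\<^sub>R y) = r *\<^sub>R bracket x y"
    and bracket_alternating: "x \<in> L \<Longrightarrow> bracket x x = 0"
    and jacobi:
      "x \<in> L \<Longrightarrow> y \<in> L \<Longrightarrow> z \<in> L \<Longrightarrow>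
        bracket x (bracket y z) + bracket y (bracket z x) + bracket z (bracket x y) = 0"

locale inner_product_space_on =
  fixes L :: "'a::real_vector set"
    and ip :: "'a \<Rightarrow> 'a \<Rightarrow> real"
  assumes ip_commute: "x \<in> L \<Longrightarrow> y \<in> L \<Longrightarrow> ip x y = ip y x"
    and ip_add_left: "x \<in> L \<Longrightarrow> y \<in> L \<Longrightarrow> z \<in> L \<Longrightarrow> ip (x + y) z = ip x z + ip y z"
    and ip_scale_left: "x \<in> L \<Longrightarrow> y \<in> L \<Longrightarrow> ip (r *\<^sub>R x) y = r * ip x y"
    and ip_pos: "x \<in> L \<Longrightarrow> x \<noteq> 0 \<Longrightarrow> 0 < ip x x"

text \<open>
  The trace of a linear endomorphism of the finite-dimensional subspace \<open>V\<close>, computed in an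
  arbitrary basis of \<open>V\<close>.
\<close>

definition trace_on :: "'a::real_vector set \<Rightarrow> ('a \<Rightarrow> 'a) \<Rightarrow> real" where
  "trace_on V f =
    (let B = (SOME B. independent B \<and> span B = V) in \<Sum>b\<in>B. representation B (f b) b)"

locale metric_lie_algebra = real_lie_algebra L bracket + inner_product_space_on L ip
  for L :: "'a::real_vector set"
    and bracket :: "'a \<Rightarrow> 'a \<Rightarrow> 'a"
    and ip :: "'a \<Rightarrow> 'a \<Rightarrow> real"
begin

definition ad :: "'a \<Rightarrow> 'a \<Rightarrow> 'a" where
  "ad X = (\<lambda>Y. bracket X Y)"

definition orthonormal_basis :: "'a set \<Rightarrow> bool" where
  "orthonormal_basis E \<longleftrightarrow>
    finite E \<and> span E = L \<and> (\<forall>x\<in>E. \<forall>y\<in>E. ip x y = (if x = y then 1 else 0))"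

text \<open>
  Linearity on \<open>L\<close> need not be required separately in the next two definitions: it follows from the
  nondegeneracy of \<open>ip\<close>.  The operators chosen below by \<open>SOME\<close> are uniquely determined on \<open>L\<close>.
\<close>

definition symmetric_operator :: "('a \<Rightarrow> 'a) \<Rightarrow> bool" where
  "symmetric_operator A \<longleftrightarrow>
    (\<forall>X\<in>L. A X \<in> L) \<and> (\<forall>X\<in>L. \<forall>Y\<in>L. ip (A X) Y = ip X (A Y))"

definition transpose_op :: "('a \<Rightarrow> 'a) \<Rightarrow> 'a \<Rightarrow> 'a" where
  "transpose_op A =
    (SOME A'. (\<forall>X\<in>L. A' X \<in> L) \<and> (\<forall>X\<in>L. \<forall>Y\<in>L. ip (A X) Y = ip X (A' Y)))"

definition sym_part :: "('a \<Rightarrow> 'a) \<Rightarrow> 'a \<Rightarrow> 'a" where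
  "sym_part A = (\<lambda>X. (1/2) *\<^sub>R (A X + transpose_op A X))"

definition mean_curvature_vector :: 'a where
  "mean_curvature_vector = (THE H. H \<in> L \<and> (\<forall>X\<in>L. ip H X = trace_on L (ad X)))"

definition killing_op :: "'a \<Rightarrow> 'a" where
  "killing_op =
    (SOME B. symmetric_operator B \<and> (\<forall>X\<in>L. ip (B X) X = trace_on L (ad X \<circ> ad X)))"

definition moment_op :: "'a \<Rightarrow> 'a" where
  "moment_op =
    (SOME M. symmetric_operator M \<and>
      (\<forall>E. orthonormal_basis E \<longrightarrow>
        (\<forall>X\<in>L. ip (M X) X =
          - (1/2) * (\<Sum>Xi\<in>E. \<Sum>Xj\<in>E. (ip (bracket X Xi) Xj)\<^sup>2)
          + (1/4) * (\<Sum>Xi\<in>E. \<Sum>Xj\<in>E. (ip (bracket Xi Xj) X)\<^sup>2))))"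

definition ricci_op :: "'a \<Rightarrow> 'a" where
  "ricci_op = (\<lambda>X. moment_op X - (1/2) *\<^sub>R killing_op X - sym_part (ad mean_curvature_vector) X)"

definition negative_ricci_curvature :: bool where
  "negative_ricci_curvature \<longleftrightarrow> (\<forall>X\<in>L. X \<noteq> 0 \<longrightarrow> ip (ricci_op X) X < 0)"

end

definition admits_negative_ricci ::
  "'a::real_vector set \<Rightarrow> ('a \<Rightarrow> 'a \<Rightarrow> 'a) \<Rightarrow> bool" where
  "admits_negative_ricci L bracket \<longleftrightarrow>
    (\<exists>ip. metric_lie_algebra L bracket ip \<and>
          metric_lie_algebra.negative_ricci_curvature L bracket ip)"


section \<open>The representation on homogeneous polynomials\<close>

text \<open>Pointwise real vector space structure on functions.\<close>

instantiation "fun" :: (type, real_vector) real_vector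
begin

definition "r *\<^sub>R f = (\<lambda>x. r *\<^sub>R f x)"

instance
  by standard (simp_all add: scaleR_fun_def fun_eq_iff scaleR_add_right scaleR_add_left)

end

text \<open>
  Polynomials are represented by the functions on \<open>\<complex>\<^sup>m\<close> they define; \<open>\<alpha>\<close> ranges over the
  (finitely many) exponent vectors of total degree \<open>n\<close>.
\<close>

definition homogeneous_polys :: "nat \<Rightarrow> ((complex ^ 'm::finite) \<Rightarrow> complex) set" where
  "homogeneous_polys n =
    {P. \<exists>a :: ('m \<Rightarrow> nat) \<Rightarrow> complex.
          P = (\<lambda>z. \<Sum>\<alpha> | (\<Sum>i\<in>UNIV. \<alpha> i) = n. a \<alpha> * (\<Prod>i\<in>UNIV. (z $ i) ^ \<alpha> i))}"

definition matrix_exp :: "real ^ 'm ^ 'm \<Rightarrow> real ^ 'm ^ 'm::finite" where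
  "matrix_exp A = (\<Sum>k. (1 / fact k) *\<^sub>R (((**) A ^^ k) (mat 1)))"

definition poly_rep ::
  "real ^ 'm ^ 'm \<Rightarrow> ((complex ^ 'm::finite) \<Rightarrow> complex) \<Rightarrow> (complex ^ 'm) \<Rightarrow> complex" where
  "poly_rep X P = (\<lambda>z.
    vector_derivative (\<lambda>t. P (map_matrix complex_of_real (matrix_exp (- t *\<^sub>R X)) *v z)) (at 0))"

text \<open>
  Extension from \<open>\<ss>\<ll>\<close> to \<open>\<gg>\<ll> = \<real> I \<oplus> \<ss>\<ll>\<close> with \<open>I\<close> acting as the scalar \<open>c\<close>:
  the component of \<open>A\<close> along \<open>I\<close> is \<open>tr A / m\<close>.
\<close>

definition gl_rep ::
  "real \<Rightarrow> real ^ 'm ^ 'm \<Rightarrow> ((complex ^ 'm::finite) \<Rightarrow> complex) \<Rightarrow> (complex ^ 'm) \<Rightarrow> complex" where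
  "gl_rep c A P =
    (let s = trace A / real CARD('m) in (c * s) *\<^sub>R P + poly_rep (A - s *\<^sub>R mat 1) P)"

definition gl_semidirect_bracket ::
  "(real ^ 'm ^ 'm \<Rightarrow> 'w \<Rightarrow> 'w) \<Rightarrow> (real ^ 'm ^ 'm::finite) \<times> 'w::real_vector \<Rightarrow>
    (real ^ 'm ^ 'm) \<times> 'w \<Rightarrow> (real ^ 'm ^ 'm) \<times> 'w" where
  "gl_semidirect_bracket \<rho> x y =
    (fst x ** fst y - fst y ** fst x, \<rho> (fst x) (snd y) - \<rho> (fst y) (snd x))"

end

theory Submission
  imports Defs
begin

text \<open>
  Let \<open>W\<close> be the module, \<open>U\<close> a basis of it declared orthonormal and \<open>d\<close> its real dimension.  The
  inner product makes \<open>I\<close>, \<open>\<ss>\<ll>\<close> and \<open>W\<close> mutually orthogonal, restricts to \<open>R tr(A\<^sup>T B)\<close> on \<open>\<ss>\<ll>\<close>, and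
  gives \<open>I\<close> squared length \<open>m\<close>.  Since \<open>\<ss>\<ll>\<close> acts on \<open>W\<close> by traceless operators, the mean curvature
  vector is \<open>(c d / m) I\<close>: it is central in \<open>\<gg>\<ll>\<close> and acts on \<open>W\<close> by the positive scalar \<open>c\<^sup>2 d / m\<close>.
  For \<open>X = (A, P)\<close> with \<open>A = s I + A0\<close>, \<open>A0\<close> traceless, and \<open>\<pi>_uv\<close> the matrix of \<open>A0\<close> in the basis
  \<open>U\<close>, the Ricci form at \<open>X\<close> is the sum of three separate contributions:

  \<^item> \<open>- s\<^sup>2 c\<^sup>2 d\<close>, negative unless \<open>s = 0\<close>;
  \<^item> \<open>- (c\<^sup>2 d / m) |P|\<^sup>2\<close> plus a quadratic form in \<open>P\<close> that carries the factor \<open>1 / (2 R)\<close>, hence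
    negative for large \<open>R\<close>;
  \<^item> \<open>- (m/2) |A0|\<^sup>2 - m tr(A0\<^sup>2) - (1/4) \<Sum>_{u,v} (\<pi>_uv + \<pi>_vu)\<^sup>2\<close>, which does not depend on \<open>R\<close>.

  The first two terms of the last item are the Ricci form of \<open>\<ss>\<ll>\<close> alone.  It is positive on the
  skew-symmetric matrices, so the symmetric part of \<open>\<pi>\<close> has to compensate for it.  With an inner
  product on \<open>W\<close> invariant under rotations it could not, because skew-symmetric matrices would act
  skew-symmetrically.  The orthonormal basis consists therefore of the monomials \<open>z\<^sup>\<alpha>\<close> and \<open>\<i> z\<^sup>\<alpha>\<close>
  rescaled by \<open>t ^ (- \<Sum>_k idx k * \<alpha> k)\<close>, for an enumeration \<open>idx\<close> of the variables.  This multiplies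
  the action of the elementary matrix \<open>E_ij\<close> by \<open>S = t ^ (idx j - idx i)\<close> and, for large \<open>t\<close>, makes the
  unipotent half of each skew-symmetric matrix dominate.  The two basis vectors proportional to
  \<open>z_i ^ n\<close> and \<open>z_i ^ (n-1) * z_j\<close> already suffice: with \<open>x = A_ij\<close> and \<open>y = A_ji\<close>, the entries
  \<open>(i, j)\<close> and \<open>(j, i)\<close> contribute at least
  \<open>(m/2) (x\<^sup>2 + y\<^sup>2) + 2 m x y + (1/4) (n S x + y / S)\<^sup>2\<close>
  to the negative of the third item, and this is positive definite for large \<open>S\<close>.

  The general formula for the Ricci form is \<open>ricci_form\<close>, its evaluation and the choice of \<open>R\<close> are in
  \<open>admits_negative_ricci_semidirect\<close>, and the choice of \<open>t\<close> is in \<open>ricci_form_positive\<close>.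
  That polynomial functions form a module for the derivative of the group action is
  \<open>poly_rep_commutator\<close>, and that the coordinates of a polynomial are well defined is
  \<open>monomials_independent\<close>.
\<close>

section \<open>The Ricci form in an orthonormal basis\<close>

context inner_product_space_on
begin

lemma ip_add_right: "x \<in> L \<Longrightarrow> y \<in> L \<Longrightarrow> z \<in> L \<Longrightarrow> y + z \<in> L \<Longrightarrow> ip x (y + z) = ip x y + ip x z"
  using ip_add_left ip_commute by metis

lemma ip_scale_right: "x \<in> L \<Longrightarrow> y \<in> L \<Longrightarrow> r *\<^sub>R y \<in> L \<Longrightarrow> ip x (r *\<^sub>R y) = r * ip x y"
  using ip_scale_left ip_commute by metis

end

context metric_lie_algebra
begin

lemma add_closed: "x \<in> L \<Longrightarrow> y \<in> L \<Longrightarrow> x + y \<in> L"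
  and scale_closed: "x \<in> L \<Longrightarrow> r *\<^sub>R x \<in> L"
  and zero_closed: "0 \<in> L"
  and diff_closed: "x \<in> L \<Longrightarrow> y \<in> L \<Longrightarrow> x - y \<in> L"
  and sum_closed: "(\<And>i. i \<in> I \<Longrightarrow> f i \<in> L) \<Longrightarrow> sum f I \<in> L"
  using subspace_L by (auto intro: subspace_add subspace_scale subspace_0 subspace_diff subspace_sum)

lemma orthonormal_basis_in_L: "orthonormal_basis E \<Longrightarrow> e \<in> E \<Longrightarrow> e \<in> L"
  unfolding orthonormal_basis_def using span_base by blast

lemma linear_on_sum:
  fixes g :: "'a \<Rightarrow> 'b::real_vector"
  assumes "\<And>x y. x \<in> L \<Longrightarrow> y \<in> L \<Longrightarrow> g (x + y) = g x + g y"
    and "\<And>r x. x \<in> L \<Longrightarrow> g (r *\<^sub>R x) = r *\<^sub>R g x"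
    and "\<And>i. i \<in> I \<Longrightarrow> f i \<in> L"
  shows "g (\<Sum>i\<in>I. a i *\<^sub>R f i) = (\<Sum>i\<in>I. a i *\<^sub>R g (f i))"
proof -
  have g0: "g 0 = 0" using assms(2)[OF zero_closed, of 0] by simp
  show ?thesis using assms(3)
  proof (induction I rule: infinite_finite_induct)
    case (insert i I)
    have "(\<Sum>i\<in>I. a i *\<^sub>R f i) \<in> L" using insert.prems by (intro sum_closed scale_closed) auto
    then show ?case using insert by (simp add: assms scale_closed)
  qed (simp_all add: g0)
qed

lemma ip_sum_scale_left:
  "y \<in> L \<Longrightarrow> (\<And>i. i \<in> I \<Longrightarrow> f i \<in> L) \<Longrightarrow> ip (\<Sum>i\<in>I. a i *\<^sub>R f i) y = (\<Sum>i\<in>I. a i * ip (f i) y)"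
  using linear_on_sum[of "\<lambda>x. ip x y" I f a] by (simp add: ip_add_left ip_scale_left)

lemma orthonormal_expansion:
  assumes E: "orthonormal_basis E" and x: "x \<in> L"
  shows "(\<Sum>e\<in>E. ip x e *\<^sub>R e) = x"
proof -
  have fin: "finite E" and span: "span E = L"
    and orth: "\<And>e f. e \<in> E \<Longrightarrow> f \<in> E \<Longrightarrow> ip e f = (if e = f then 1 else 0)"
    using E unfolding orthonormal_basis_def by auto
  obtain a where a: "x = (\<Sum>e\<in>E. a e *\<^sub>R e)"
    using x span span_finite[OF fin] by auto
  have "ip x f = a f" if "f \<in> E" for f
  proof -
    have "ip x f = (\<Sum>e\<in>E. a e * ip e f)"
      unfolding a using that E orthonormal_basis_in_L by (intro ip_sum_scale_left) auto
    also have "\<dots> = (\<Sum>e\<in>E. if e = f then a e else 0)"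
      using that by (intro sum.cong refl) (simp add: orth)
    also have "\<dots> = a f" using that fin by simp
    finally show ?thesis .
  qed
  then show ?thesis unfolding a by simp
qed

lemma parseval:
  assumes E: "orthonormal_basis E" and x: "x \<in> L" and y: "y \<in> L"
  shows "ip x y = (\<Sum>e\<in>E. ip x e * ip y e)"
proof -
  have "ip x y = ip (\<Sum>e\<in>E. ip x e *\<^sub>R e) y" by (simp only: orthonormal_expansion[OF E x])
  also have "\<dots> = (\<Sum>e\<in>E. ip x e * ip e y)"
    using E orthonormal_basis_in_L y by (intro ip_sum_scale_left) auto
  also have "\<dots> = (\<Sum>e\<in>E. ip x e * ip y e)"
    using E orthonormal_basis_in_L y by (intro sum.cong refl) (auto simp: ip_commute)
  finally show ?thesis .
qed

text \<open>
  The definition of the trace refers to some unspecified basis \<open>B\<close>.  Writing both the image of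
  \<open>b \<in> B\<close> in terms of \<open>E\<close> and each \<open>e \<in> E\<close> in terms of \<open>B\<close> turns one sum into the other.
\<close>

lemma trace_on_orthonormal:
  assumes E: "orthonormal_basis E"
    and closed: "\<And>x. x \<in> L \<Longrightarrow> f x \<in> L"
    and add: "\<And>x y. x \<in> L \<Longrightarrow> y \<in> L \<Longrightarrow> f (x + y) = f x + f y"
    and scale: "\<And>r x. x \<in> L \<Longrightarrow> f (r *\<^sub>R x) = r *\<^sub>R f x"
  shows "trace_on L f = (\<Sum>e\<in>E. ip (f e) e)"
proof -
  note EL = orthonormal_basis_in_L[OF E]
  have finE: "finite E" and spanE: "span E = L"
    using E unfolding orthonormal_basis_def by auto
  define B where "B = (SOME B. independent B \<and> span B = L)"
  have "\<exists>B. independent B \<and> span B = L"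
    by (metis basis_exists span_minimal subset_antisym subspace_L)
  then have indep: "independent B" and spanB: "span B = L"
    unfolding B_def by (metis (mono_tags, lifting) someI_ex)+
  have finB: "finite B"
    using independent_span_bound[OF finE indep] span_superset[of B] spanB spanE by auto
  have BL: "b \<in> L" if "b \<in> B" for b using that spanB span_base by blast
  have rep: "representation B (f b) b = (\<Sum>e\<in>E. ip (f b) e * representation B e b)" if "b \<in> B" for b
  proof -
    have "representation B (f b) b = representation B (\<Sum>e\<in>E. ip (f b) e *\<^sub>R e) b"
      using that by (simp only: orthonormal_expansion[OF E] closed BL)
    also have "\<dots> = (\<Sum>e\<in>E. representation B (ip (f b) e *\<^sub>R e) b)"
      using representation_sum[OF indep, of E "\<lambda>e. ip (f b) e *\<^sub>R e"] EL spanB scale_closed by auto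
    also have "\<dots> = (\<Sum>e\<in>E. ip (f b) e * representation B e b)"
      using EL spanB by (intro sum.cong refl) (simp add: representation_scale[OF indep])
    finally show ?thesis .
  qed
  have "trace_on L f = (\<Sum>b\<in>B. representation B (f b) b)"
    unfolding trace_on_def B_def Let_def by simp
  also have "\<dots> = (\<Sum>b\<in>B. \<Sum>e\<in>E. ip (f b) e * representation B e b)"
    using rep by simp
  also have "\<dots> = (\<Sum>e\<in>E. \<Sum>b\<in>B. representation B e b * ip (f b) e)"
    by (subst sum.swap) (simp add: mult.commute)
  also have "\<dots> = (\<Sum>e\<in>E. ip (f e) e)"
  proof (intro sum.cong refl)
    fix e assume e: "e \<in> E"
    have "(\<Sum>b\<in>B. representation B e b * ip (f b) e) = ip (\<Sum>b\<in>B. representation B e b *\<^sub>R f b) e"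
      using e EL BL closed by (intro ip_sum_scale_left[symmetric]) auto
    also have "(\<Sum>b\<in>B. representation B e b *\<^sub>R f b) = f (\<Sum>b\<in>B. representation B e b *\<^sub>R b)"
      using BL by (intro linear_on_sum[symmetric] add scale)
    also have "(\<Sum>b\<in>B. representation B e b *\<^sub>R b) = e"
      using sum_representation_eq[OF indep _ finB, of e] e EL spanB by auto
    finally show "(\<Sum>b\<in>B. representation B e b * ip (f b) e) = ip (f e) e" .
  qed
  finally show ?thesis .
qed

text \<open>
  The trace of a bilinear form with respect to the inner product.  Both sides equal the double sum
  of \<open>ip e f * q f e\<close>.
\<close>

lemma trace_form_basis_independent:
  fixes q :: "'a \<Rightarrow> 'a \<Rightarrow> real"
  assumes E: "orthonormal_basis E" and F: "orthonormal_basis F"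
    and addl: "\<And>x y z. x \<in> L \<Longrightarrow> y \<in> L \<Longrightarrow> z \<in> L \<Longrightarrow> q (x + y) z = q x z + q y z"
    and scalel: "\<And>r x z. x \<in> L \<Longrightarrow> z \<in> L \<Longrightarrow> q (r *\<^sub>R x) z = r * q x z"
    and addr: "\<And>x y z. x \<in> L \<Longrightarrow> y \<in> L \<Longrightarrow> z \<in> L \<Longrightarrow> q z (x + y) = q z x + q z y"
    and scaler: "\<And>r x z. x \<in> L \<Longrightarrow> z \<in> L \<Longrightarrow> q z (r *\<^sub>R x) = r * q z x"
  shows "(\<Sum>e\<in>E. q e e) = (\<Sum>f\<in>F. q f f)"
proof -
  note EL = orthonormal_basis_in_L[OF E] and FL = orthonormal_basis_in_L[OF F]
  have "(\<Sum>e\<in>E. q e e) = (\<Sum>e\<in>E. \<Sum>f\<in>F. ip e f * q f e)"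
  proof (intro sum.cong refl)
    fix e assume e: "e \<in> E"
    have "q e e = q (\<Sum>f\<in>F. ip e f *\<^sub>R f) e" by (simp only: orthonormal_expansion[OF F] EL e)
    also have "\<dots> = (\<Sum>f\<in>F. ip e f * q f e)"
      using linear_on_sum[of "\<lambda>x. q x e" F "\<lambda>f. f" "ip e"] addl scalel EL FL e by simp
    finally show "q e e = \<dots>" .
  qed
  also have "\<dots> = (\<Sum>f\<in>F. \<Sum>e\<in>E. ip f e * q f e)"
    using EL FL by (subst sum.swap) (auto intro!: sum.cong simp: ip_commute)
  also have "\<dots> = (\<Sum>f\<in>F. q f f)"
  proof (intro sum.cong refl)
    fix f assume f: "f \<in> F"
    have "q f f = q f (\<Sum>e\<in>E. ip f e *\<^sub>R e)" by (simp only: orthonormal_expansion[OF E] FL f)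
    also have "\<dots> = (\<Sum>e\<in>E. ip f e * q f e)"
      using linear_on_sum[of "\<lambda>x. q f x" E "\<lambda>f. f" "ip f"] addr scaler EL FL f by simp
    finally show "(\<Sum>e\<in>E. ip f e * q f e) = q f f" by simp
  qed
  finally show ?thesis .
qed

text \<open>
  The operators in the definition of the Ricci operator are given by Hilbert choice, so each of them
  must be shown to exist before anything can be said about it.
\<close>

lemma ex_representing_operator:
  fixes q :: "'a \<Rightarrow> 'a \<Rightarrow> real"
  assumes E: "orthonormal_basis E"
    and add: "\<And>x y z. x \<in> L \<Longrightarrow> y \<in> L \<Longrightarrow> z \<in> L \<Longrightarrow> q x (y + z) = q x y + q x z"
    and scale: "\<And>r x z. x \<in> L \<Longrightarrow> z \<in> L \<Longrightarrow> q x (r *\<^sub>R z) = r * q x z"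
  shows "\<exists>A. (\<forall>X\<in>L. A X \<in> L) \<and> (\<forall>X\<in>L. \<forall>Y\<in>L. ip (A X) Y = q X Y)"
proof (intro exI conjI ballI)
  note EL = orthonormal_basis_in_L[OF E]
  let ?A = "\<lambda>X. \<Sum>e\<in>E. q X e *\<^sub>R e"
  show "?A X \<in> L" for X using EL by (intro sum_closed scale_closed)
  fix X Y assume X: "X \<in> L" and Y: "Y \<in> L"
  have "ip (?A X) Y = (\<Sum>e\<in>E. q X e * ip e Y)" using Y EL by (intro ip_sum_scale_left)
  also have "\<dots> = (\<Sum>e\<in>E. ip Y e * q X e)"
    using EL Y by (intro sum.cong refl) (simp add: ip_commute mult.commute)
  also have "\<dots> = q X (\<Sum>e\<in>E. ip Y e *\<^sub>R e)"
    using linear_on_sum[of "\<lambda>x. q X x" E "\<lambda>f. f" "ip Y"] add scale EL X by simp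
  also have "\<dots> = q X Y" by (simp only: orthonormal_expansion[OF E Y])
  finally show "ip (?A X) Y = q X Y" .
qed

lemma ex_symmetric_operator:
  fixes q :: "'a \<Rightarrow> 'a \<Rightarrow> real"
  assumes E: "orthonormal_basis E"
    and add: "\<And>x y z. x \<in> L \<Longrightarrow> y \<in> L \<Longrightarrow> z \<in> L \<Longrightarrow> q x (y + z) = q x y + q x z"
    and scale: "\<And>r x z. x \<in> L \<Longrightarrow> z \<in> L \<Longrightarrow> q x (r *\<^sub>R z) = r * q x z"
    and sym: "\<And>x y. x \<in> L \<Longrightarrow> y \<in> L \<Longrightarrow> q x y = q y x"
  shows "\<exists>A. symmetric_operator A \<and> (\<forall>X\<in>L. ip (A X) X = q X X)"
proof -
  obtain A where A: "\<forall>X\<in>L. A X \<in> L" "\<forall>X\<in>L. \<forall>Y\<in>L. ip (A X) Y = q X Y"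
    using ex_representing_operator[of E q, OF E add scale] by blast
  then have "ip X (A Y) = q X Y" if "X \<in> L" "Y \<in> L" for X Y
    using that sym ip_commute[of X "A Y"] by auto
  then show ?thesis unfolding symmetric_operator_def using A by auto
qed

lemmas bracket_linear = bracket_add_left bracket_add_right bracket_scale_left bracket_scale_right

lemma killing_op_form:
  assumes E: "orthonormal_basis E" and X: "X \<in> L"
  shows "killing_op X \<in> L" "ip (killing_op X) X = (\<Sum>e\<in>E. ip (bracket X (bracket X e)) e)"
proof -
  note EL = orthonormal_basis_in_L[OF E]
  define q where "q = (\<lambda>x y. \<Sum>e\<in>E. ip (bracket x (bracket y e)) e)"
  have sym: "q x y = q y x" if x: "x \<in> L" and y: "y \<in> L" for x y
  proof -
    have half: "(\<Sum>e\<in>E. ip (bracket x (bracket y e)) e)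
        = (\<Sum>e\<in>E. \<Sum>f\<in>E. ip (bracket y e) f * ip (bracket x f) e)" if x: "x \<in> L" and y: "y \<in> L" for x y
    proof (intro sum.cong refl)
      fix e assume e: "e \<in> E"
      have be: "bracket y e \<in> L" using e EL y bracket_closed by auto
      have "ip (bracket x (bracket y e)) e = ip (bracket x (\<Sum>f\<in>E. ip (bracket y e) f *\<^sub>R f)) e"
        by (simp only: orthonormal_expansion[OF E be])
      also have "\<dots> = (\<Sum>f\<in>E. ip (bracket y e) f * ip (bracket x f) e)"
        using linear_on_sum[of "\<lambda>u. ip (bracket x u) e" E "\<lambda>f. f" "ip (bracket y e)"] EL e x
        by (simp add: bracket_linear ip_add_left ip_scale_left bracket_closed)
      finally show "ip (bracket x (bracket y e)) e = \<dots>" .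
    qed
    show ?thesis unfolding q_def half[OF x y] half[OF y x]
      by (subst sum.swap) (simp add: mult.commute)
  qed
  have "\<exists>A. symmetric_operator A \<and> (\<forall>X\<in>L. ip (A X) X = q X X)"
  proof (rule ex_symmetric_operator[of E q, OF E _ _ sym])
    show "q x (y + z) = q x y + q x z" if "x \<in> L" "y \<in> L" "z \<in> L" for x y z
      unfolding q_def sum.distrib[symmetric] using that EL
      by (intro sum.cong refl) (simp add: bracket_linear ip_add_left bracket_closed)
    show "q x (r *\<^sub>R z) = r * q x z" if "x \<in> L" "z \<in> L" for r x z
      unfolding q_def sum_distrib_left using that EL
      by (intro sum.cong refl) (simp add: bracket_linear ip_scale_left bracket_closed)
  qed
  moreover have tr: "trace_on L (ad Z \<circ> ad Z) = q Z Z" if "Z \<in> L" for Z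
    unfolding q_def using that
    by (subst trace_on_orthonormal[OF E]) (auto simp: ad_def bracket_linear bracket_closed)
  ultimately have "\<exists>B. symmetric_operator B \<and> (\<forall>X\<in>L. ip (B X) X = trace_on L (ad X \<circ> ad X))"
    by auto
  from someI_ex[OF this, folded killing_op_def] show "killing_op X \<in> L"
    "ip (killing_op X) X = (\<Sum>e\<in>E. ip (bracket X (bracket X e)) e)"
    using X tr[OF X] unfolding symmetric_operator_def q_def by auto
qed

text \<open>
  The defining property of the moment operator quantifies over all orthonormal bases.  The operator
  is built from one basis, and both quadratic sums are traces of bilinear forms, the second one in
  each of its two arguments, so their values are the same in every basis.
\<close>

lemma moment_op_form:
  assumes E: "orthonormal_basis E" and X: "X \<in> L"
  shows "moment_op X \<in> L"
    "ip (moment_op X) X = - (1/2) * (\<Sum>e\<in>E. \<Sum>f\<in>E. (ip (bracket X e) f)\<^sup>2)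
          + (1/4) * (\<Sum>e\<in>E. \<Sum>f\<in>E. (ip (bracket e f) X)\<^sup>2)"
proof -
  note EL = orthonormal_basis_in_L[OF E]
  define q where "q = (\<lambda>x y. - (1/2) * (\<Sum>e\<in>E. \<Sum>f\<in>E. ip (bracket x e) f * ip (bracket y e) f)
          + (1/4) * (\<Sum>e\<in>E. \<Sum>f\<in>E. ip (bracket e f) x * ip (bracket e f) y))"
  have "\<exists>A. symmetric_operator A \<and> (\<forall>X\<in>L. ip (A X) X = q X X)"
  proof (rule ex_symmetric_operator[of E q, OF E])
    show "q x (y + z) = q x y + q x z" if "x \<in> L" "y \<in> L" "z \<in> L" for x y z
    proof -
      have "(\<Sum>e\<in>E. \<Sum>f\<in>E. ip (bracket x e) f * ip (bracket (y + z) e) f)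
          = (\<Sum>e\<in>E. \<Sum>f\<in>E. ip (bracket x e) f * ip (bracket y e) f)
            + (\<Sum>e\<in>E. \<Sum>f\<in>E. ip (bracket x e) f * ip (bracket z e) f)"
        unfolding sum.distrib[symmetric] using that EL
        by (intro sum.cong refl) (simp add: bracket_linear ip_add_left bracket_closed distrib_left)
      moreover have "(\<Sum>e\<in>E. \<Sum>f\<in>E. ip (bracket e f) x * ip (bracket e f) (y + z))
          = (\<Sum>e\<in>E. \<Sum>f\<in>E. ip (bracket e f) x * ip (bracket e f) y)
            + (\<Sum>e\<in>E. \<Sum>f\<in>E. ip (bracket e f) x * ip (bracket e f) z)"
        unfolding sum.distrib[symmetric] using that EL
        by (intro sum.cong refl) (simp add: ip_add_right bracket_closed distrib_left add_closed)
      ultimately show ?thesis unfolding q_def by (simp add: algebra_simps)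
    qed
    show "q x (r *\<^sub>R z) = r * q x z" if "x \<in> L" "z \<in> L" for r x z
    proof -
      have "(\<Sum>e\<in>E. \<Sum>f\<in>E. ip (bracket x e) f * ip (bracket (r *\<^sub>R z) e) f)
          = r * (\<Sum>e\<in>E. \<Sum>f\<in>E. ip (bracket x e) f * ip (bracket z e) f)"
        unfolding sum_distrib_left using that EL
        by (intro sum.cong refl) (simp add: bracket_linear ip_scale_left bracket_closed)
      moreover have "(\<Sum>e\<in>E. \<Sum>f\<in>E. ip (bracket e f) x * ip (bracket e f) (r *\<^sub>R z))
          = r * (\<Sum>e\<in>E. \<Sum>f\<in>E. ip (bracket e f) x * ip (bracket e f) z)"
        unfolding sum_distrib_left using that EL
        by (intro sum.cong refl) (simp add: ip_scale_right bracket_closed scale_closed)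
      ultimately show ?thesis unfolding q_def by (simp add: algebra_simps)
    qed
    show "q x y = q y x" for x y unfolding q_def by (simp add: mult.commute)
  qed
  then obtain M where M: "symmetric_operator M" "\<forall>X\<in>L. ip (M X) X = q X X" by blast
  have first: "(\<Sum>e\<in>E. \<Sum>f\<in>E. (ip (bracket Z e) f)\<^sup>2)
        = (\<Sum>e\<in>F. \<Sum>f\<in>F. (ip (bracket Z e) f)\<^sup>2)" if F: "orthonormal_basis F" and Z: "Z \<in> L" for F Z
  proof -
    have *: "(\<Sum>e\<in>G. \<Sum>f\<in>G. (ip (bracket Z e) f)\<^sup>2) = (\<Sum>e\<in>G. ip (bracket Z e) (bracket Z e))"
      if G: "orthonormal_basis G" for G
      using Z orthonormal_basis_in_L[OF G]
      by (intro sum.cong refl) (simp add: parseval[OF G, symmetric] bracket_closed power2_eq_square)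
    show ?thesis unfolding *[OF E] *[OF F]
      using Z by (intro trace_form_basis_independent[OF E F])
        (auto simp: bracket_linear bracket_closed ip_add_left ip_scale_left
          ip_add_right ip_scale_right add_closed scale_closed)
  qed
  have second: "(\<Sum>e\<in>E. \<Sum>f\<in>E. (ip (bracket e f) Z)\<^sup>2)
        = (\<Sum>e\<in>F. \<Sum>f\<in>F. (ip (bracket e f) Z)\<^sup>2)" if F: "orthonormal_basis F" and Z: "Z \<in> L" for F Z
  proof -
    note FL = orthonormal_basis_in_L[OF F]
    have "(\<Sum>e\<in>E. \<Sum>f\<in>E. (ip (bracket e f) Z)\<^sup>2) = (\<Sum>e\<in>E. \<Sum>f\<in>F. (ip (bracket e f) Z)\<^sup>2)"
      unfolding power2_eq_square
      using EL Z by (intro sum.cong refl trace_form_basis_independent[OF E F])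
        (auto simp: bracket_linear bracket_closed ip_add_left ip_scale_left algebra_simps)
    also have "\<dots> = (\<Sum>f\<in>F. \<Sum>e\<in>E. (ip (bracket e f) Z)\<^sup>2)" by (rule sum.swap)
    also have "\<dots> = (\<Sum>f\<in>F. \<Sum>e\<in>F. (ip (bracket e f) Z)\<^sup>2)"
      unfolding power2_eq_square
      using FL Z by (intro sum.cong refl trace_form_basis_independent[OF E F])
        (auto simp: bracket_linear bracket_closed ip_add_left ip_scale_left algebra_simps)
    also have "\<dots> = (\<Sum>e\<in>F. \<Sum>f\<in>F. (ip (bracket e f) Z)\<^sup>2)" by (rule sum.swap)
    finally show ?thesis .
  qed
  have "\<exists>M. symmetric_operator M \<and>
      (\<forall>E. orthonormal_basis E \<longrightarrow>
        (\<forall>X\<in>L. ip (M X) X =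
          - (1/2) * (\<Sum>Xi\<in>E. \<Sum>Xj\<in>E. (ip (bracket X Xi) Xj)\<^sup>2)
          + (1/4) * (\<Sum>Xi\<in>E. \<Sum>Xj\<in>E. (ip (bracket Xi Xj) X)\<^sup>2)))"
    using M by (intro exI[of _ M] conjI allI impI ballI)
      (simp_all add: q_def power2_eq_square[symmetric] first second)
  note moment = someI_ex[OF this, folded moment_op_def]
  show "moment_op X \<in> L"
    using moment[THEN conjunct1] X unfolding symmetric_operator_def by simp
  show "ip (moment_op X) X = - (1/2) * (\<Sum>e\<in>E. \<Sum>f\<in>E. (ip (bracket X e) f)\<^sup>2)
          + (1/4) * (\<Sum>e\<in>E. \<Sum>f\<in>E. (ip (bracket e f) X)\<^sup>2)"
    using moment[THEN conjunct2] X E by simp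
qed

lemma sym_part_form:
  assumes E: "orthonormal_basis E" and X: "X \<in> L"
    and closed: "\<And>x. x \<in> L \<Longrightarrow> f x \<in> L"
    and add: "\<And>x y. x \<in> L \<Longrightarrow> y \<in> L \<Longrightarrow> f (x + y) = f x + f y"
    and scale: "\<And>r x. x \<in> L \<Longrightarrow> f (r *\<^sub>R x) = r *\<^sub>R f x"
  shows "sym_part f X \<in> L" "ip (sym_part f X) X = ip (f X) X"
proof -
  obtain A' where A': "\<forall>X\<in>L. A' X \<in> L" "\<forall>X\<in>L. \<forall>Y\<in>L. ip (A' X) Y = ip X (f Y)"
    using ex_representing_operator[of E "\<lambda>X Y. ip X (f Y)", OF E]
    by (auto simp: closed add scale ip_add_right ip_scale_right add_closed scale_closed)
  then have "\<forall>X\<in>L. \<forall>Y\<in>L. ip (f X) Y = ip X (A' Y)" using closed ip_commute by metis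
  then have "\<exists>A'. (\<forall>X\<in>L. A' X \<in> L) \<and> (\<forall>X\<in>L. \<forall>Y\<in>L. ip (f X) Y = ip X (A' Y))"
    using A'(1) by blast
  from someI_ex[OF this, folded transpose_op_def]
  have t: "transpose_op f X \<in> L" "ip (f X) X = ip X (transpose_op f X)"
    using X by auto
  show "sym_part f X \<in> L" unfolding sym_part_def using t X closed
    by (simp add: add_closed scale_closed)
  show "ip (sym_part f X) X = ip (f X) X" unfolding sym_part_def
    using t X closed ip_commute[OF X t(1)]
    by (simp add: add_closed scale_closed ip_scale_left ip_add_left)
qed

lemma mean_curvature_vector_eqI:
  assumes E: "orthonormal_basis E" and H: "H \<in> L"
    and tr: "\<And>X. X \<in> L \<Longrightarrow> ip H X = (\<Sum>e\<in>E. ip (bracket X e) e)"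
  shows "mean_curvature_vector = H"
  unfolding mean_curvature_vector_def
proof (rule the_equality)
  have trace: "trace_on L (ad X) = (\<Sum>e\<in>E. ip (bracket X e) e)" if "X \<in> L" for X
    using that by (subst trace_on_orthonormal[OF E]) (auto simp: ad_def bracket_linear bracket_closed)
  then show "H \<in> L \<and> (\<forall>X\<in>L. ip H X = trace_on L (ad X))" using H tr by simp
  fix H' assume H': "H' \<in> L \<and> (\<forall>X\<in>L. ip H' X = trace_on L (ad X))"
  have "(\<Sum>e\<in>E. ip H' e *\<^sub>R e) = (\<Sum>e\<in>E. ip H e *\<^sub>R e)"
    using H' trace tr orthonormal_basis_in_L[OF E] by (intro sum.cong refl) simp
  then show "H' = H" using H' H by (simp add: orthonormal_expansion[OF E])
qed

text \<open>
  The inner sum of the first part of the moment operator collapses by Parseval's identity, and the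
  symmetric part of \<open>ad H\<close> has the same quadratic form as \<open>ad H\<close>.
\<close>

lemma ricci_form:
  assumes E: "orthonormal_basis E" and H: "H \<in> L"
    and tr: "\<forall>X\<in>L. ip H X = (\<Sum>e\<in>E. ip (bracket X e) e)"
    and X: "X \<in> L"
  shows "ip (ricci_op X) X =
      - (1/2) * (\<Sum>e\<in>E. ip (bracket X e) (bracket X e))
      + (1/4) * (\<Sum>e\<in>E. \<Sum>f\<in>E. (ip (bracket e f) X)\<^sup>2)
      - (1/2) * (\<Sum>e\<in>E. ip (bracket X (bracket X e)) e)
      - ip (bracket H X) X"
proof -
  have H_eq: "mean_curvature_vector = H" using tr by (intro mean_curvature_vector_eqI[OF E H]) simp
  have s: "sym_part (ad H) X \<in> L" "ip (sym_part (ad H) X) X = ip (bracket H X) X"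
    using sym_part_form[OF E X, of "ad H"] H
    by (auto simp: ad_def bracket_linear bracket_closed)
  have diff: "ip (x - y) z = ip x z - ip y z" if "x \<in> L" "y \<in> L" "z \<in> L" for x y z
    using ip_add_left[of "x - y" y z] that diff_closed by simp
  have p: "(\<Sum>e\<in>E. \<Sum>f\<in>E. (ip (bracket X e) f)\<^sup>2) = (\<Sum>e\<in>E. ip (bracket X e) (bracket X e))"
    using X orthonormal_basis_in_L[OF E]
    by (intro sum.cong refl) (simp add: parseval[OF E, symmetric] bracket_closed power2_eq_square)
  note m = moment_op_form[OF E X] and k = killing_op_form[OF E X]
  have "ip (ricci_op X) X
      = ip (moment_op X) X - (1/2) * ip (killing_op X) X - ip (sym_part (ad H) X) X"
    unfolding ricci_op_def H_eq
    by (simp only: diff diff_closed scale_closed ip_scale_left m(1) k(1) s(1) X)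
  then show ?thesis unfolding m(2) k(2) s(2) p .
qed

end

section \<open>Trace identities for square matrices\<close>

lemma bounded_bilinear_matrix_mult:
  "bounded_bilinear ((**) :: real^'m^'m \<Rightarrow> real^'m^'m \<Rightarrow> real^'m^'m)"
proof -
  have "linear (\<lambda>B :: real^'m^'m. A ** B)" "linear (\<lambda>B :: real^'m^'m. B ** A)" for A :: "real^'m^'m"
    by (auto intro!: linearI simp: matrix_add_ldistrib matrix_matrix_mult_def vec_eq_iff
        sum.distrib sum_distrib_left algebra_simps)
  then show ?thesis by (simp add: bilinear_conv_bounded_bilinear[symmetric] bilinear_def)
qed

interpretation matrix_mult: bounded_bilinear "(**) :: real^'m^'m \<Rightarrow> real^'m^'m \<Rightarrow> real^'m^'m"
  by (rule bounded_bilinear_matrix_mult)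

lemma trace_scaleR: "trace (r *\<^sub>R A) = r * trace (A :: real^'m^'m)"
  by (simp add: trace_def sum_distrib_left)

lemma trace_transpose: "trace (transpose A) = trace (A :: real^'m^'m)"
  by (simp add: trace_def transpose_def)

lemma trace_zero: "trace (0 :: real^'m^'m) = 0"
  by (simp add: trace_def)

lemma trace_mat_1: "trace (mat 1 :: real^'m^'m) = real CARD('m)"
  by (simp add: trace_def mat_def)

lemma trace_commutator: "trace (A ** B - B ** A :: real^'m^'m) = 0"
  using trace_mul_sym[of A B] by (simp add: trace_sub)

lemma inner_matrix_eq_trace: "A \<bullet> B = trace (transpose A ** B)" for A B :: "real^'m^'m"
  unfolding inner_vec_def trace_def matrix_matrix_mult_def transpose_def
  by (simp, rule sum.swap)

lemma inner_mat_1: "A \<bullet> mat 1 = trace A" for A :: "real^'m^'m"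
  by (simp add: inner_matrix_eq_trace trace_transpose)

lemma inner_matrix_mult_left: "(A ** B) \<bullet> C = B \<bullet> (transpose A ** C)" for A B C :: "real^'m^'m"
  by (simp add: inner_matrix_eq_trace matrix_transpose_mul matrix_mul_assoc)

lemma inner_matrix_mult_right: "(B ** A) \<bullet> C = B \<bullet> (C ** transpose A)" for A B C :: "real^'m^'m"
  using trace_mul_sym[of "transpose A" "transpose B ** C"]
  by (simp add: inner_matrix_eq_trace matrix_transpose_mul matrix_mul_assoc)

lemma inner_transpose_matrices: "transpose A \<bullet> transpose B = A \<bullet> B" for A B :: "real^'m^'m"
  unfolding inner_vec_def transpose_def by (simp, rule sum.swap)

lemma sum_Basis_matrix:
  "(\<Sum>b\<in>(Basis :: (real^'m^'m) set). f b) = (\<Sum>i\<in>UNIV. \<Sum>j\<in>UNIV. f (axis i (axis j 1)))"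
proof -
  have "(Basis :: (real^'m^'m) set) = (\<lambda>(i, j). axis i (axis j 1)) ` (UNIV \<times> UNIV)"
    unfolding Basis_vec_def by auto
  moreover have inj: "inj_on (\<lambda>(i :: 'm, j :: 'm). axis i (axis j (1::real))) (UNIV \<times> UNIV)"
    by (auto simp: inj_on_def axis_eq_axis)
  ultimately show ?thesis
    using sum.reindex[OF inj, of f] by (simp add: sum.cartesian_product case_prod_beta)
qed

text \<open>
  The trace of the endomorphism \<open>b \<mapsto> A b C\<close> of the space of matrices.  All trace identities for
  \<open>ad A\<close> below reduce to this one, because adjoints of left and right multiplication are
  multiplications by the transposed matrix.
\<close>

lemma sum_Basis_sandwich: 
  "(\<Sum>b\<in>Basis. (A ** b ** C) \<bullet> b) = trace A * trace C" for A C :: "real^'m^'m"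
proof -
  have "(A ** axis i (axis j 1) ** C) \<bullet> axis i (axis j 1) = A $ i $ i * C $ j $ j" for i j :: 'm
  proof -
    have left: "(A ** axis i (axis j 1)) $ i $ k = (if k = j then A $ i $ i else 0)" for k
    proof -
      have "A $ i $ l * axis i (axis j 1) $ l $ k
          = (if l = i then (if k = j then A $ i $ i else 0) else 0)" for l
        by (auto simp: axis_def)
      then show ?thesis by (simp add: matrix_matrix_mult_def)
    qed
    have "(A ** axis i (axis j 1) ** C) $ i $ j = (\<Sum>k\<in>UNIV. (A ** axis i (axis j 1)) $ i $ k * C $ k $ j)"
      by (simp add: matrix_matrix_mult_def)
    also have "\<dots> = (\<Sum>k\<in>UNIV. if k = j then A $ i $ i * C $ j $ j else 0)"
      by (intro sum.cong refl) (simp add: left)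
    finally show ?thesis by (simp add: inner_axis)
  qed
  then show ?thesis by (simp add: sum_Basis_matrix trace_def sum_product)
qed

lemma trace_ad_transpose_ad:
  fixes A :: "real^'m^'m"
  shows "(\<Sum>b\<in>Basis. (A ** b - b ** A) \<bullet> (A ** b - b ** A))
    = 2 * (real CARD('m) * (A \<bullet> A) - (trace A)\<^sup>2)"
proof -
  have "(A ** b - b ** A) \<bullet> (A ** b - b ** A)
     = ((transpose A ** A) ** b ** mat 1) \<bullet> b - (A ** b ** transpose A) \<bullet> b
      - (transpose A ** b ** A) \<bullet> b + (mat 1 ** b ** (A ** transpose A)) \<bullet> b" for b
    using inner_matrix_mult_left[of A b "A ** b"] inner_matrix_mult_right[of b A "A ** b"]
      inner_matrix_mult_left[of A b "b ** A"] inner_matrix_mult_right[of b A "b ** A"]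
    by (simp add: inner_diff_left inner_diff_right matrix_mul_assoc inner_commute)
  then have "(\<Sum>b\<in>Basis. (A ** b - b ** A) \<bullet> (A ** b - b ** A))
     = trace (transpose A ** A) * real CARD('m) - 2 * (trace A * trace A)
       + real CARD('m) * trace (A ** transpose A)"
    by (simp only: sum.distrib sum_subtractf sum_Basis_sandwich trace_mat_1 trace_transpose)
  then show ?thesis
    using trace_mul_sym[of A "transpose A"]
    by (simp add: inner_matrix_eq_trace power2_eq_square algebra_simps)
qed

lemma trace_ad_ad:
  fixes A :: "real^'m^'m"
  shows "(\<Sum>b\<in>Basis. (A ** (A ** b - b ** A) - (A ** b - b ** A) ** A) \<bullet> b)
    = 2 * (real CARD('m) * trace (A ** A) - (trace A)\<^sup>2)"
proof -
  have "(A ** (A ** b - b ** A) - (A ** b - b ** A) ** A) \<bullet> b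
     = ((A ** A) ** b ** mat 1) \<bullet> b - 2 * ((A ** b ** A) \<bullet> b) + (mat 1 ** b ** (A ** A)) \<bullet> b" for b
    by (simp only: matrix_mult.diff_left matrix_mult.diff_right inner_diff_left matrix_mul_assoc
        matrix_mul_lid matrix_mul_rid)
  then have "(\<Sum>b\<in>Basis. (A ** (A ** b - b ** A) - (A ** b - b ** A) ** A) \<bullet> b)
     = trace (A ** A) * real CARD('m) - 2 * (trace A * trace A) + real CARD('m) * trace (A ** A)"
    by (simp only: sum.distrib sum_subtractf sum_Basis_sandwich trace_mat_1 sum_distrib_left[symmetric])
  then show ?thesis by (simp add: power2_eq_square algebra_simps)
qed

section \<open>An orthonormal basis adapted to the splitting into scalars and traceless matrices\<close>

text \<open>
  A Euclidean space with zero bracket is a metric Lie algebra, which makes the results on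
  orthonormal bases above available for its standard inner product.
\<close>

lemma metric_lie_algebra_abelian: 
  "metric_lie_algebra UNIV (\<lambda>_ _. 0) ((\<bullet>) :: 'a::euclidean_space \<Rightarrow> 'a \<Rightarrow> real)"
proof
  show "\<exists>B. finite B \<and> (UNIV :: 'a set) = span B"
    by (intro exI[of _ Basis]) simp
qed (simp_all add: inner_commute inner_add_right)

lemma sum_orthonormal_eq_sum_Basis:
  fixes q :: "'a::euclidean_space \<Rightarrow> 'a \<Rightarrow> real"
  assumes q: "bilinear q" and E: "finite E" "span E = UNIV"
    and orth: "\<And>x y. x \<in> E \<Longrightarrow> y \<in> E \<Longrightarrow> x \<bullet> y = (if x = y then 1 else 0)"
  shows "(\<Sum>e\<in>E. q e e) = (\<Sum>b\<in>Basis. q b b)"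
proof -
  interpret metric_lie_algebra UNIV "\<lambda>_ _. 0" "(\<bullet>) :: 'a \<Rightarrow> 'a \<Rightarrow> real"
    by (rule metric_lie_algebra_abelian)
  show ?thesis
    using q E orth
    by (intro trace_form_basis_independent)
      (auto simp: orthonormal_basis_def inner_Basis bilinear_ladd bilinear_radd bilinear_lmul bilinear_rmul)
qed

lemma orthonormal_parseval:
  fixes x y :: "'a::euclidean_space"
  assumes E: "finite E" "span E = UNIV"
    and orth: "\<And>x y. x \<in> E \<Longrightarrow> y \<in> E \<Longrightarrow> x \<bullet> y = (if x = y then 1 else 0)"
  shows "(\<Sum>e\<in>E. (x \<bullet> e) * (y \<bullet> e)) = x \<bullet> y"
proof -
  interpret metric_lie_algebra UNIV "\<lambda>_ _. 0" "(\<bullet>) :: 'a \<Rightarrow> 'a \<Rightarrow> real"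
    by (rule metric_lie_algebra_abelian)
  show ?thesis using E orth parseval[of E x y] by (simp add: orthonormal_basis_def)
qed

definition unit_scalar :: "real^'m^'m" where
  "unit_scalar = (1 / sqrt (real CARD('m))) *\<^sub>R mat 1"

lemma inner_unit_scalar: "A \<bullet> unit_scalar = trace A / sqrt (real CARD('m))" for A :: "real^'m^'m"
  by (simp add: unit_scalar_def inner_mat_1)

lemma trace_unit_scalar: "trace (unit_scalar :: real^'m^'m) = sqrt (real CARD('m))"
  by (simp add: unit_scalar_def trace_scaleR trace_mat_1 real_div_sqrt)

lemma unit_scalar_commutes: "unit_scalar ** B = B ** unit_scalar" for B :: "real^'m^'m"
  by (simp add: unit_scalar_def matrix_mult.scaleR_left matrix_mult.scaleR_right)

text \<open>
  Orthonormal for the standard inner product \<open>tr(A\<^sup>T B)\<close>.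
\<close>

definition sl_basis :: "(real^'m^'m) set \<Rightarrow> bool" where
  "sl_basis F \<longleftrightarrow> finite F \<and> span F = {A. trace A = 0} \<and>
    (\<forall>x\<in>F. \<forall>y\<in>F. x \<bullet> y = (if x = y then 1 else 0))"

lemma ex_sl_basis: "\<exists>F :: (real^'m^'m) set. sl_basis F"
proof -
  have "subspace {A :: real^'m^'m. trace A = 0}"
    by (auto simp: subspace_def trace_add trace_scaleR trace_zero)
  then obtain F where F: "pairwise orthogonal F" "\<And>x. x \<in> F \<Longrightarrow> norm x = 1"
      "independent F" "span F = {A :: real^'m^'m. trace A = 0}"
    using orthonormal_basis_subspace by metis
  have "x \<bullet> y = (if x = y then 1 else 0)" if "x \<in> F" "y \<in> F" for x y
    using F(1,2) that by (auto simp: pairwise_def orthogonal_def norm_eq_1)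
  then show ?thesis unfolding sl_basis_def using F independent_imp_finite by blast
qed

context
  fixes F :: "(real^'m^'m) set"
  assumes F: "sl_basis F"
begin

lemma sl_basis_trace: "B \<in> F \<Longrightarrow> trace B = 0"
  using F span_base unfolding sl_basis_def by blast

lemma unit_scalar_not_in_sl_basis: "unit_scalar \<notin> F"
  using sl_basis_trace[of unit_scalar] by (auto simp: unit_scalar_def trace_scaleR trace_mat_1)

lemma insert_sl_basis_orthonormal:
  assumes "x \<in> insert unit_scalar F" "y \<in> insert unit_scalar F"
  shows "x \<bullet> y = (if x = y then 1 else 0)"
proof -
  have "(unit_scalar :: real^'m^'m) \<bullet> unit_scalar = 1"
    by (simp add: inner_unit_scalar trace_unit_scalar)
  moreover have "B \<bullet> unit_scalar = 0" "unit_scalar \<bullet> B = 0" if "B \<in> F" for B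
    using that by (simp_all add: inner_unit_scalar sl_basis_trace inner_commute[of unit_scalar])
  ultimately show ?thesis
    using assms F unit_scalar_not_in_sl_basis unfolding sl_basis_def by auto
qed

lemma span_insert_sl_basis: "span (insert unit_scalar F) = UNIV"
proof (intro set_eqI iffI UNIV_I)
  fix A :: "real^'m^'m"
  have "trace (A - (trace A / real CARD('m)) *\<^sub>R mat 1) = 0"
    by (simp add: trace_sub trace_scaleR trace_mat_1)
  moreover have "(mat 1 :: real^'m^'m) = sqrt (real CARD('m)) *\<^sub>R unit_scalar"
    by (simp add: unit_scalar_def)
  ultimately have "A - (trace A / real CARD('m) * sqrt (real CARD('m))) *\<^sub>R unit_scalar \<in> span F"
    using F by (simp add: sl_basis_def)
  then show "A \<in> span (insert unit_scalar F)" unfolding span_insert by blast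
qed

text \<open>
  A form that vanishes on scalar matrices, such as any form built from commutators, has the same
  trace over the traceless matrices as over all matrices, where the elementary matrices are an
  explicit basis.
\<close>

lemma sum_sl_basis:
  assumes q: "bilinear q" and unit: "q unit_scalar unit_scalar = 0"
  shows "(\<Sum>B\<in>F. q B B) = (\<Sum>b\<in>Basis. q b (b :: real^'m^'m) :: real)"
proof -
  have "(\<Sum>b\<in>Basis. q b b) = (\<Sum>B\<in>insert unit_scalar F. q B B)"
    using F span_insert_sl_basis insert_sl_basis_orthonormal
    by (intro sum_orthonormal_eq_sum_Basis[symmetric] q) (auto simp: sl_basis_def)
  then show ?thesis
    using F unit unit_scalar_not_in_sl_basis by (simp add: sl_basis_def)
qed

lemma sum_sl_basis_ad_ad:
  fixes A :: "real^'m^'m"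
  shows "(\<Sum>B\<in>F. (A ** (A ** B - B ** A) - (A ** B - B ** A) ** A) \<bullet> B)
    = 2 * (real CARD('m) * trace (A ** A) - (trace A)\<^sup>2)"
proof -
  have "bilinear (\<lambda>B C. (A ** (A ** B - B ** A) - (A ** B - B ** A) ** A) \<bullet> C)"
    unfolding bilinear_def
    by (auto intro!: linearI simp: matrix_mult.diff_left matrix_mult.diff_right matrix_mult.add_left
        matrix_mult.add_right inner_diff_left inner_add_left inner_add_right algebra_simps
        matrix_mult.scaleR_left matrix_mult.scaleR_right)
  from sum_sl_basis[OF this] show ?thesis
    by (simp add: trace_ad_ad unit_scalar_commutes matrix_mult.zero_left matrix_mult.zero_right)
qed

lemma sum_sl_basis_ad:
  fixes A :: "real^'m^'m"
  shows "(\<Sum>B\<in>F. (A ** B - B ** A) \<bullet> B) = 0"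
proof -
  have "bilinear (\<lambda>B C. (A ** B - B ** A) \<bullet> C)"
    unfolding bilinear_def
    by (auto intro!: linearI simp: matrix_mult.add_left matrix_mult.add_right inner_diff_left
        inner_add_left inner_add_right algebra_simps matrix_mult.scaleR_left matrix_mult.scaleR_right)
  from sum_sl_basis[OF this]
  have "(\<Sum>B\<in>F. (A ** B - B ** A) \<bullet> B) = (\<Sum>b\<in>Basis. (A ** b - b ** A) \<bullet> b)"
    by (simp add: unit_scalar_commutes)
  also have "\<dots> = (\<Sum>b\<in>Basis. (A ** b ** (mat 1 :: real^'m^'m)) \<bullet> b)
      - (\<Sum>b\<in>Basis. ((mat 1 :: real^'m^'m) ** b ** A) \<bullet> b)"
    by (simp add: inner_diff_left sum_subtractf)
  also have "\<dots> = 0" by (simp only: sum_Basis_sandwich) simp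
  finally show ?thesis .
qed

lemma sum_sl_basis_ad_transpose_ad:
  fixes A :: "real^'m^'m"
  shows "(\<Sum>B\<in>F. (A ** B - B ** A) \<bullet> (A ** B - B ** A))
    = 2 * (real CARD('m) * (A \<bullet> A) - (trace A)\<^sup>2)"
proof -
  have "bilinear (\<lambda>B C. (A ** B - B ** A) \<bullet> (A ** C - C ** A))"
    unfolding bilinear_def
    by (auto intro!: linearI simp: matrix_mult.add_left
        matrix_mult.add_right inner_diff_left inner_diff_right inner_add_left inner_add_right algebra_simps
        matrix_mult.scaleR_left matrix_mult.scaleR_right)
  from sum_sl_basis[OF this] show ?thesis
    by (simp add: trace_ad_transpose_ad unit_scalar_commutes)
qed

text \<open>
  For fixed \<open>B\<close> the sum over \<open>C\<close> is the squared norm of the commutator of the transpose of \<open>B\<close> with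
  \<open>A\<close>, by Parseval; transposing it gives the operator \<open>ad\<close> of the transpose of \<open>A\<close>, applied to \<open>B\<close>.
\<close>

lemma sum_sl_basis_commutator:
  fixes A :: "real^'m^'m"
  shows "(\<Sum>B\<in>F. \<Sum>C\<in>F. ((B ** C - C ** B) \<bullet> A)\<^sup>2)
    = 2 * (real CARD('m) * (A \<bullet> A) - (trace A)\<^sup>2)"
proof -
  have adj: "(B ** C - C ** B) \<bullet> A = (transpose B ** A - A ** transpose B) \<bullet> C" for B C
    using inner_matrix_mult_left[of B C A] inner_matrix_mult_right[of C B A]
    by (simp add: inner_diff_left inner_diff_right inner_commute[of _ C])
  have transp: "transpose (transpose B ** A - A ** transpose B)
      = transpose A ** B - B ** transpose A" for B
    by (simp add: matrix_transpose_mul transpose_def vec_eq_iff matrix_matrix_mult_def mult.commute)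
  have "(\<Sum>C\<in>F. ((B ** C - C ** B) \<bullet> A)\<^sup>2)
      = (transpose A ** B - B ** transpose A) \<bullet> (transpose A ** B - B ** transpose A)" if "B \<in> F" for B
  proof -
    let ?D = "transpose B ** A - A ** transpose B"
    have "(\<Sum>C\<in>F. ((B ** C - C ** B) \<bullet> A)\<^sup>2) = (\<Sum>C\<in>insert unit_scalar F. (?D \<bullet> C) * (?D \<bullet> C))"
      using F unit_scalar_not_in_sl_basis
      by (simp add: sl_basis_def adj power2_eq_square inner_unit_scalar trace_commutator)
    also have "\<dots> = ?D \<bullet> ?D"
      using F span_insert_sl_basis insert_sl_basis_orthonormal
      by (intro orthonormal_parseval) (auto simp: sl_basis_def)
    also have "\<dots> = transpose ?D \<bullet> transpose ?D" by (simp add: inner_transpose_matrices)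
    finally show ?thesis unfolding transp .
  qed
  then show ?thesis
    by (simp add: sum_sl_basis_ad_transpose_ad trace_transpose inner_transpose_matrices)
qed

end

section \<open>Semidirect products with the general linear algebra\<close>

text \<open>
  A module on which scalar matrices act by multiples of the identity, together with a basis \<open>U\<close>
  that is to become orthonormal.  The choice of \<open>U\<close> is the freedom in the inner product on \<open>W\<close>.
\<close>

locale gl_module =
  fixes \<rho> :: "real^'m^'m \<Rightarrow> 'w::real_vector \<Rightarrow> 'w" and W U :: "'w set" and c :: real
  assumes finite_U: "finite U" and independent_U: "independent U" and span_U: "span U = W"
    and rep_closed: "P \<in> W \<Longrightarrow> \<rho> A P \<in> W"
    and rep_add_left: "P \<in> W \<Longrightarrow> \<rho> (A + B) P = \<rho> A P + \<rho> B P"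
    and rep_scale_left: "P \<in> W \<Longrightarrow> \<rho> (r *\<^sub>R A) P = r *\<^sub>R \<rho> A P"
    and rep_add_right: "P \<in> W \<Longrightarrow> Q \<in> W \<Longrightarrow> \<rho> A (P + Q) = \<rho> A P + \<rho> A Q"
    and rep_scale_right: "P \<in> W \<Longrightarrow> \<rho> A (r *\<^sub>R P) = r *\<^sub>R \<rho> A P"
    and rep_commutator: "P \<in> W \<Longrightarrow> \<rho> (A ** B - B ** A) P = \<rho> A (\<rho> B P) - \<rho> B (\<rho> A P)"
    and rep_mat_1: "P \<in> W \<Longrightarrow> \<rho> (mat 1) P = c *\<^sub>R P"
begin

abbreviation coord :: "'w \<Rightarrow> 'w \<Rightarrow> real" where
  "coord u P \<equiv> representation U P u"

definition ipW :: "'w \<Rightarrow> 'w \<Rightarrow> real" where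
  "ipW P Q = (\<Sum>u\<in>U. coord u P * coord u Q)"

lemma W_subspace: "subspace W"
  using span_U by (metis subspace_span)

lemma W_closed: "0 \<in> W" "P \<in> W \<Longrightarrow> Q \<in> W \<Longrightarrow> P + Q \<in> W" "P \<in> W \<Longrightarrow> Q \<in> W \<Longrightarrow> P - Q \<in> W"
    "P \<in> W \<Longrightarrow> r *\<^sub>R P \<in> W" "P \<in> W \<Longrightarrow> - P \<in> W" "u \<in> U \<Longrightarrow> u \<in> W"
  using W_subspace span_U
  by (auto intro: subspace_0 subspace_add subspace_diff subspace_scale subspace_neg span_base)

lemma rep_diff_left: "P \<in> W \<Longrightarrow> \<rho> (A - B) P = \<rho> A P - \<rho> B P"
  using rep_add_left[of P "A - B" B] by simp

lemma rep_diff_right: "P \<in> W \<Longrightarrow> Q \<in> W \<Longrightarrow> \<rho> A (P - Q) = \<rho> A P - \<rho> A Q"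
  using rep_add_right[of "P - Q" Q A] W_closed by simp

lemma rep_zero_right [simp]: "\<rho> A 0 = 0"
  using rep_scale_right[of 0 A 0] W_closed by simp

lemma rep_zero_left [simp]: "P \<in> W \<Longrightarrow> \<rho> 0 P = 0"
  using rep_scale_left[of P 0 0] by simp

lemma coord_add: "P \<in> W \<Longrightarrow> Q \<in> W \<Longrightarrow> coord u (P + Q) = coord u P + coord u Q"
  using representation_add[OF independent_U, of Q P] span_U by (simp add: add.commute)

lemma coord_scale: "P \<in> W \<Longrightarrow> coord u (r *\<^sub>R P) = r * coord u P"
  using representation_scale[OF independent_U, of P r] span_U by simp

lemma coord_basis: "v \<in> U \<Longrightarrow> coord u v = (if u = v then 1 else 0)"
  using representation_basis[OF independent_U, of v] by auto

lemma coord_expansion: "P \<in> W \<Longrightarrow> (\<Sum>u\<in>U. coord u P *\<^sub>R u) = P"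
  using sum_representation_eq[OF independent_U _ finite_U, of P] span_U by auto

lemma ipW_commute: "ipW P Q = ipW Q P"
  by (simp add: ipW_def mult.commute)

lemma ipW_add_left: "P \<in> W \<Longrightarrow> Q \<in> W \<Longrightarrow> ipW (P + Q) S = ipW P S + ipW Q S"
  by (simp add: ipW_def coord_add sum.distrib distrib_right)

lemma ipW_scale_left: "P \<in> W \<Longrightarrow> ipW (r *\<^sub>R P) S = r * ipW P S"
  by (simp add: ipW_def coord_scale sum_distrib_left mult.assoc)

lemma ipW_scale_right: "P \<in> W \<Longrightarrow> ipW S (r *\<^sub>R P) = r * ipW S P"
  using ipW_scale_left ipW_commute by metis

lemma ipW_minus_left: "P \<in> W \<Longrightarrow> ipW (- P) S = - ipW P S"
  using ipW_scale_left[of P "-1" S] by simp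

lemma ipW_minus_right: "P \<in> W \<Longrightarrow> ipW S (- P) = - ipW S P"
  using ipW_minus_left ipW_commute by metis

lemma ipW_zero: "ipW 0 P = 0" "ipW P 0 = 0"
  using ipW_scale_left[of 0 0 P] ipW_scale_right[of 0 P 0] W_closed by simp_all

lemma ipW_basis: "u \<in> U \<Longrightarrow> ipW P u = coord u P"
  using finite_U by (simp add: ipW_def coord_basis if_distrib[of "\<lambda>x. _ * x"] cong: if_cong)

lemma ipW_basis_left: "u \<in> U \<Longrightarrow> ipW u P = coord u P"
  using ipW_basis ipW_commute by metis

lemma ipW_nonneg: "0 \<le> ipW P P"
  by (simp add: ipW_def sum_nonneg)

lemma ipW_pos: "P \<in> W \<Longrightarrow> P \<noteq> 0 \<Longrightarrow> 0 < ipW P P"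
proof -
  assume P: "P \<in> W" "P \<noteq> 0"
  have "ipW P P \<noteq> 0"
  proof
    assume "ipW P P = 0"
    then have "coord u P = 0" if "u \<in> U" for u
      using that finite_U by (simp add: ipW_def sum_nonneg_eq_0_iff)
    then show False using coord_expansion[OF P(1)] P(2) by simp
  qed
  then show ?thesis using ipW_nonneg[of P] by simp
qed

lemma ipW_Cauchy_Schwarz: "(ipW P Q)\<^sup>2 \<le> ipW P P * ipW Q Q"
  using Cauchy_Schwarz_ineq_sum[of "\<lambda>u. coord u P" "\<lambda>u. coord u Q" U]
  by (simp add: ipW_def power2_eq_square)

text \<open>
  On traceless matrices this is \<open>R\<close> times the standard inner product, while scalar matrices keep
  their standard length and stay orthogonal to the traceless ones.
\<close>

definition metric :: "real \<Rightarrow> (real^'m^'m) \<times> 'w \<Rightarrow> (real^'m^'m) \<times> 'w \<Rightarrow> real" where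
  "metric R x y = R * (fst x \<bullet> fst y)
    + (1 - R) * (trace (fst x) * trace (fst y)) / real CARD('m) + ipW (snd x) (snd y)"

lemma trace_squared_le: "(trace A)\<^sup>2 \<le> real CARD('m) * (A \<bullet> A)" for A :: "real^'m^'m"
  using Cauchy_Schwarz_ineq[of A "mat 1"] inner_mat_1[of "mat 1 :: real^'m^'m"]
  by (simp add: inner_mat_1 trace_mat_1 mult.commute)

lemma metric_lie_algebra_semidirect:
  assumes R: "R > 0"
  shows "metric_lie_algebra (UNIV \<times> W) (gl_semidirect_bracket \<rho>) (metric R)"
proof
  show "subspace (UNIV \<times> W :: ((real^'m^'m) \<times> 'w) set)"
    by (intro subspace_Times subspace_UNIV W_subspace)
  have "UNIV \<times> W = span ((\<lambda>b. (b, 0)) ` (Basis :: (real^'m^'m) set) \<union> Pair 0 ` U)"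
  proof (intro subset_antisym subsetI)
    fix x :: "(real^'m^'m) \<times> 'w" assume "x \<in> UNIV \<times> W"
    have "linear (\<lambda>b :: real^'m^'m. (b, 0 :: 'w))" "linear (Pair (0 :: real^'m^'m) :: 'w \<Rightarrow> _)"
      by (auto intro!: linearI)
    from linear_span_image[OF this(1), of Basis] linear_span_image[OF this(2), of U]
    have "(fst x, 0 :: 'w) \<in> span ((\<lambda>b. (b, 0)) ` (Basis :: (real^'m^'m) set))"
      "(0 :: real^'m^'m, snd x) \<in> span (Pair 0 ` U)"
      using \<open>x \<in> UNIV \<times> W\<close> span_U by auto
    then have "(fst x, 0) + (0, snd x) \<in> span ((\<lambda>b. (b, 0)) ` (Basis :: (real^'m^'m) set) \<union> Pair 0 ` U)"
      by (intro span_add) (meson span_mono Un_upper1 Un_upper2 subsetD)+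
    then show "x \<in> span ((\<lambda>b. (b, 0)) ` (Basis :: (real^'m^'m) set) \<union> Pair 0 ` U)" by simp
  next
    fix x assume "x \<in> span ((\<lambda>b. (b, 0)) ` (Basis :: (real^'m^'m) set) \<union> Pair 0 ` U)"
    moreover have "span ((\<lambda>b. (b, 0)) ` (Basis :: (real^'m^'m) set) \<union> Pair 0 ` U) \<subseteq> UNIV \<times> W"
      using W_closed by (intro span_minimal subspace_Times subspace_UNIV W_subspace) auto
    ultimately show "x \<in> UNIV \<times> W" by blast
  qed
  then show "\<exists>B. finite B \<and> (UNIV \<times> W :: ((real^'m^'m) \<times> 'w) set) = span B"
    using finite_U by (intro exI[of _ "(\<lambda>b. (b, 0)) ` Basis \<union> Pair 0 ` U"]) simp
  show "gl_semidirect_bracket \<rho> x y \<in> UNIV \<times> W" if "x \<in> UNIV \<times> W" "y \<in> UNIV \<times> W" for x y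
    using that by (auto simp: gl_semidirect_bracket_def intro!: W_closed(3) rep_closed)
  show "gl_semidirect_bracket \<rho> (x + y) z = gl_semidirect_bracket \<rho> x z + gl_semidirect_bracket \<rho> y z"
    if "x \<in> UNIV \<times> W" "y \<in> UNIV \<times> W" "z \<in> UNIV \<times> W" for x y z
    using that by (auto simp: gl_semidirect_bracket_def rep_add_left rep_add_right
        matrix_mult.add_left matrix_mult.add_right)
  show "gl_semidirect_bracket \<rho> x (y + z) = gl_semidirect_bracket \<rho> x y + gl_semidirect_bracket \<rho> x z"
    if "x \<in> UNIV \<times> W" "y \<in> UNIV \<times> W" "z \<in> UNIV \<times> W" for x y z
    using that by (auto simp: gl_semidirect_bracket_def rep_add_left rep_add_right
        matrix_mult.add_left matrix_mult.add_right)
  show "gl_semidirect_bracket \<rho> (r *\<^sub>R x) y = r *\<^sub>R gl_semidirect_bracket \<rho> x y"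
    if "x \<in> UNIV \<times> W" "y \<in> UNIV \<times> W" for x y r
    using that by (auto simp: gl_semidirect_bracket_def rep_scale_left rep_scale_right
        matrix_mult.scaleR_left matrix_mult.scaleR_right scaleR_diff_right)
  show "gl_semidirect_bracket \<rho> x (r *\<^sub>R y) = r *\<^sub>R gl_semidirect_bracket \<rho> x y"
    if "x \<in> UNIV \<times> W" "y \<in> UNIV \<times> W" for x y r
    using that by (auto simp: gl_semidirect_bracket_def rep_scale_left rep_scale_right
        matrix_mult.scaleR_left matrix_mult.scaleR_right scaleR_diff_right)
  show "gl_semidirect_bracket \<rho> x x = 0" if "x \<in> UNIV \<times> W" for x
    by (simp add: gl_semidirect_bracket_def zero_prod_def)
  show "gl_semidirect_bracket \<rho> x (gl_semidirect_bracket \<rho> y z)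
      + gl_semidirect_bracket \<rho> y (gl_semidirect_bracket \<rho> z x)
      + gl_semidirect_bracket \<rho> z (gl_semidirect_bracket \<rho> x y) = 0"
    if "x \<in> UNIV \<times> W" "y \<in> UNIV \<times> W" "z \<in> UNIV \<times> W" for x y z
    using that
    by (auto simp: gl_semidirect_bracket_def rep_diff_right rep_commutator rep_closed zero_prod_def
        matrix_mult.diff_left matrix_mult.diff_right matrix_mul_assoc)
  show "metric R x y = metric R y x" for x y
    by (simp add: metric_def inner_commute ipW_commute mult.commute)
  show "metric R (x + y) z = metric R x z + metric R y z"
    if "x \<in> UNIV \<times> W" "y \<in> UNIV \<times> W" "z \<in> UNIV \<times> W" for x y z
    using that by (auto simp: metric_def inner_add_left ipW_add_left trace_add
        distrib_left distrib_right add_divide_distrib)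
  show "metric R (r *\<^sub>R x) y = r * metric R x y" if "x \<in> UNIV \<times> W" "y \<in> UNIV \<times> W" for r x y
    using that by (auto simp: metric_def ipW_scale_left trace_scaleR distrib_left)
  show "0 < metric R x x" if x: "x \<in> UNIV \<times> W" "x \<noteq> 0" for x
  proof -
    let ?A = "fst x" and ?m = "real CARD('m)"
    have split: "metric R x x
        = R * (?A \<bullet> ?A - (trace ?A)\<^sup>2 / ?m) + (trace ?A)\<^sup>2 / ?m + ipW (snd x) (snd x)"
      by (simp add: metric_def power2_eq_square algebra_simps diff_divide_distrib)
    have defect: "0 \<le> R * (?A \<bullet> ?A - (trace ?A)\<^sup>2 / ?m)"
      using trace_squared_le[of ?A] R by (simp add: field_simps)
    have tr: "0 \<le> (trace ?A)\<^sup>2 / ?m" by simp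
    show ?thesis
    proof (cases "snd x = 0")
      case False
      then have "0 < ipW (snd x) (snd x)" using x by (intro ipW_pos) auto
      then show ?thesis unfolding split using defect tr by linarith
    next
      case True
      then have A: "?A \<bullet> ?A > 0" using x(2) by (auto simp: prod_eq_iff)
      have "0 < R * (?A \<bullet> ?A - (trace ?A)\<^sup>2 / ?m) + (trace ?A)\<^sup>2 / ?m"
      proof (cases "trace ?A = 0")
        case True
        then show ?thesis using A R by simp
      next
        case False
        then have "0 < (trace ?A)\<^sup>2 / ?m" by simp
        then show ?thesis using defect by linarith
      qed
      then show ?thesis unfolding split using ipW_nonneg[of "snd x"] by linarith
    qed
  qed
qed

context
  fixes R :: real and F :: "(real^'m^'m) set"
  assumes R: "R > 0" and F: "sl_basis F"
begin

interpretation metric_lie_algebra "UNIV \<times> W" "gl_semidirect_bracket \<rho>" "metric R"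
  by (rule metric_lie_algebra_semidirect[OF R])

definition frame :: "((real^'m^'m) \<times> 'w) set" where
  "frame = (\<lambda>B. ((1 / sqrt R) *\<^sub>R B, 0)) ` F \<union> insert (unit_scalar, 0) (Pair 0 ` U)"

lemma sum_frame:
  fixes h :: "(real^'m^'m) \<times> 'w \<Rightarrow> real"
  shows "(\<Sum>e\<in>frame. h e)
    = (\<Sum>B\<in>F. h ((1 / sqrt R) *\<^sub>R B, 0)) + h (unit_scalar, 0) + (\<Sum>u\<in>U. h (0, u))"
proof -
  have finF: "finite F" using F by (simp add: sl_basis_def)
  have nz: "u \<noteq> 0" if "u \<in> U" for u
    using independent_U that dependent_zero by blast
  have tr: "trace (unit_scalar :: real^'m^'m) \<noteq> 0"
    by (simp add: trace_unit_scalar)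
  have ne: "(unit_scalar :: real^'m^'m, 0 :: 'w) \<notin> Pair 0 ` U" using nz by auto
  have ne': "unit_scalar \<noteq> (1 / sqrt R) *\<^sub>R B" if "B \<in> F" for B
    using sl_basis_trace[OF F that] tr trace_scaleR[of "1 / sqrt R" B] by auto
  have disj: "(\<lambda>B. ((1 / sqrt R) *\<^sub>R B, 0)) ` F \<inter> insert (unit_scalar, 0) (Pair 0 ` U) = {}"
    using nz ne' by auto
  have inj: "inj_on (\<lambda>B :: real^'m^'m. ((1 / sqrt R) *\<^sub>R B, 0 :: 'w)) F" "inj_on (Pair (0 :: real^'m^'m)) U"
    using R by (auto simp: inj_on_def)
  show ?thesis
    unfolding frame_def
    using finF finite_U ne
    by (subst sum.union_disjoint[OF _ _ disj])
      (simp_all add: sum.reindex[OF inj(1)] sum.reindex[OF inj(2)])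
qed

lemma frame_orthonormal: "orthonormal_basis frame"
  unfolding orthonormal_basis_def
proof (intro conjI ballI)
  show "finite frame" using F finite_U by (simp add: frame_def sl_basis_def)
  have orth: "B \<bullet> C = (if B = C then 1 else 0)" if "B \<in> F" "C \<in> F" for B C
    using F that by (simp add: sl_basis_def)
  have nz: "u \<noteq> 0" if "u \<in> U" for u
    using independent_U that dependent_zero by blast
  fix x y assume "x \<in> frame" "y \<in> frame"
  then show "metric R x y = (if x = y then 1 else 0)"
    using R insert_sl_basis_orthonormal[OF F, of unit_scalar unit_scalar] nz
    by (auto simp: frame_def metric_def orth sl_basis_trace[OF F] trace_scaleR
        trace_unit_scalar inner_unit_scalar inner_commute[of unit_scalar] ipW_zero ipW_basis
        coord_basis trace_zero split: if_splits)
next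
  show "span frame = UNIV \<times> W"
  proof (intro subset_antisym subsetI)
    fix x assume "x \<in> span frame"
    moreover have "span frame \<subseteq> UNIV \<times> W"
      using W_closed by (intro span_minimal subspace_Times subspace_UNIV W_subspace)
        (auto simp: frame_def)
    ultimately show "x \<in> UNIV \<times> W" by blast
  next
    fix x :: "(real^'m^'m) \<times> 'w" assume x: "x \<in> UNIV \<times> W"
    have lin: "linear (\<lambda>b :: real^'m^'m. (b, 0 :: 'w))" "linear (Pair (0 :: real^'m^'m) :: 'w \<Rightarrow> _)"
      by (auto intro!: linearI)
    have "(\<lambda>b. (b, 0)) ` insert unit_scalar F \<subseteq> span frame"
    proof (clarify, elim insertE)
      fix B assume "B \<in> F"
      then have "sqrt R *\<^sub>R ((1 / sqrt R) *\<^sub>R B, 0 :: 'w) \<in> span frame"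
        unfolding frame_def by (intro span_scale span_base) blast
      then show "(B, 0) \<in> span frame" using R by simp
    qed (auto simp: frame_def intro: span_base)
    then have "span ((\<lambda>b. (b, 0)) ` insert unit_scalar F) \<subseteq> span frame"
      by (intro span_minimal subspace_span)
    then have "(fst x, 0) \<in> span frame"
      using linear_span_image[OF lin(1), of "insert unit_scalar F"] span_insert_sl_basis[OF F] by auto
    moreover have "span (Pair 0 ` U) \<subseteq> span frame"
      by (intro span_mono) (auto simp: frame_def)
    then have "(0, snd x) \<in> span frame"
      using linear_span_image[OF lin(2), of U] span_U x by auto
    ultimately have "(fst x, 0) + (0, snd x) \<in> span frame" by (rule span_add)
    then show "x \<in> span frame" by simp
  qed
qed


lemma rep_unit_scalar: "P \<in> W \<Longrightarrow> \<rho> unit_scalar P = (c / sqrt (real CARD('m))) *\<^sub>R P"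
  by (simp add: unit_scalar_def rep_scale_left rep_mat_1)

lemma sum_norm_ad:
  fixes A :: "real^'m^'m" and P :: 'w
  assumes P: "P \<in> W"
  defines "X \<equiv> (A, P)"
  shows "(\<Sum>e\<in>frame. metric R (gl_semidirect_bracket \<rho> X e) (gl_semidirect_bracket \<rho> X e))
    = 2 * (real CARD('m) * (A \<bullet> A) - (trace A)\<^sup>2)
      + (1 / R) * (\<Sum>B\<in>F. ipW (\<rho> B P) (\<rho> B P))
      + c\<^sup>2 / real CARD('m) * ipW P P + (\<Sum>u\<in>U. ipW (\<rho> A u) (\<rho> A u))"
proof -
  have "metric R (gl_semidirect_bracket \<rho> X ((1 / sqrt R) *\<^sub>R B, 0))
        (gl_semidirect_bracket \<rho> X ((1 / sqrt R) *\<^sub>R B, 0))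
      = (A ** B - B ** A) \<bullet> (A ** B - B ** A) + (1 / R) * ipW (\<rho> B P) (\<rho> B P)" for B
  proof -
    have br: "gl_semidirect_bracket \<rho> X ((1 / sqrt R) *\<^sub>R B, 0)
        = ((1 / sqrt R) *\<^sub>R (A ** B - B ** A), (- (1 / sqrt R)) *\<^sub>R \<rho> B P)"
      using P by (simp add: X_def gl_semidirect_bracket_def matrix_mult.scaleR_left
          matrix_mult.scaleR_right rep_scale_left scaleR_diff_right)
    show ?thesis unfolding br metric_def
      using P R by (simp add: trace_scaleR trace_commutator ipW_scale_left ipW_scale_right
          ipW_minus_left ipW_minus_right rep_closed W_closed)
  qed
  moreover have "metric R (gl_semidirect_bracket \<rho> X (unit_scalar, 0))
      (gl_semidirect_bracket \<rho> X (unit_scalar, 0)) = c\<^sup>2 / real CARD('m) * ipW P P"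
    using P by (simp add: X_def gl_semidirect_bracket_def metric_def unit_scalar_commutes trace_zero
        rep_unit_scalar ipW_minus_left ipW_minus_right ipW_scale_left ipW_scale_right W_closed
        power2_eq_square)
  moreover have "metric R (gl_semidirect_bracket \<rho> X (0, u)) (gl_semidirect_bracket \<rho> X (0, u))
      = ipW (\<rho> A u) (\<rho> A u)" for u
    using P by (simp add: X_def gl_semidirect_bracket_def metric_def trace_zero
        matrix_mult.zero_left matrix_mult.zero_right)
  ultimately show ?thesis
    by (simp add: sum_frame sum.distrib sum_sl_basis_ad_transpose_ad[OF F] sum_distrib_left)
qed

lemma sum_killing:
  fixes A :: "real^'m^'m" and P :: 'w
  assumes P: "P \<in> W"
  defines "X \<equiv> (A, P)"
  shows "(\<Sum>e\<in>frame. metric R (gl_semidirect_bracket \<rho> X (gl_semidirect_bracket \<rho> X e)) e)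
    = 2 * (real CARD('m) * trace (A ** A) - (trace A)\<^sup>2) + (\<Sum>u\<in>U. ipW (\<rho> A (\<rho> A u)) u)"
proof -
  have "metric R (gl_semidirect_bracket \<rho> X (gl_semidirect_bracket \<rho> X ((1 / sqrt R) *\<^sub>R B, 0)))
        ((1 / sqrt R) *\<^sub>R B, 0)
      = (A ** (A ** B - B ** A) - (A ** B - B ** A) ** A) \<bullet> B" for B
  proof -
    have "gl_semidirect_bracket \<rho> X ((1 / sqrt R) *\<^sub>R B, 0)
        = ((1 / sqrt R) *\<^sub>R (A ** B - B ** A), (- (1 / sqrt R)) *\<^sub>R \<rho> B P)"
      using P by (simp add: X_def gl_semidirect_bracket_def matrix_mult.scaleR_left
          matrix_mult.scaleR_right rep_scale_left scaleR_diff_right)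
    moreover have "fst (gl_semidirect_bracket \<rho> X (r *\<^sub>R D, Q)) = r *\<^sub>R (A ** D - D ** A)" for r D Q
      by (simp add: X_def gl_semidirect_bracket_def matrix_mult.scaleR_left
          matrix_mult.scaleR_right scaleR_diff_right)
    ultimately have br: "fst (gl_semidirect_bracket \<rho> X (gl_semidirect_bracket \<rho> X ((1 / sqrt R) *\<^sub>R B, 0)))
        = (1 / sqrt R) *\<^sub>R (A ** (A ** B - B ** A) - (A ** B - B ** A) ** A)"
      by simp
    show ?thesis unfolding metric_def br
      using R by (simp add: trace_scaleR trace_commutator ipW_zero)
  qed
  moreover have "metric R (gl_semidirect_bracket \<rho> X (gl_semidirect_bracket \<rho> X (unit_scalar, 0)))
      (unit_scalar, 0) = 0"
    by (simp add: X_def gl_semidirect_bracket_def metric_def unit_scalar_commutes trace_zero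
        ipW_zero matrix_mult.zero_left matrix_mult.zero_right)
  moreover have "metric R (gl_semidirect_bracket \<rho> X (gl_semidirect_bracket \<rho> X (0, u))) (0, u)
      = ipW (\<rho> A (\<rho> A u)) u" if "u \<in> U" for u
    using P that by (simp add: X_def gl_semidirect_bracket_def metric_def trace_zero
        matrix_mult.zero_left matrix_mult.zero_right rep_closed W_closed)
  ultimately show ?thesis
    by (simp add: sum_frame sum.distrib sum_sl_basis_ad_ad[OF F])
qed

text \<open>
  Only brackets of two traceless matrices and brackets of a matrix with an element of \<open>W\<close> have a
  component along \<open>(A, P)\<close>.  The latter occur in both orders, which gives the factors \<open>2\<close>.
\<close>

lemma sum_bracket_component:
  assumes P: "P \<in> W"
  shows "(\<Sum>e\<in>frame. \<Sum>f\<in>frame. (metric R (gl_semidirect_bracket \<rho> e f) (A, P))\<^sup>2)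
    = 2 * (real CARD('m) * (A \<bullet> A) - (trace A)\<^sup>2)
      + (2 / R) * (\<Sum>B\<in>F. \<Sum>u\<in>U. (ipW (\<rho> B u) P)\<^sup>2)
      + 2 * c\<^sup>2 / real CARD('m) * ipW P P"
proof -
  let ?r = "1 / sqrt R" and ?t = "\<lambda>e f. (metric R (gl_semidirect_bracket \<rho> e f) (A, P))\<^sup>2"
  have parseval: "(\<Sum>u\<in>U. (ipW u P)\<^sup>2) = ipW P P"
    by (simp add: ipW_basis_left) (simp add: ipW_def power2_eq_square)
  have 1: "?t (?r *\<^sub>R B, 0) (?r *\<^sub>R C, 0) = ((B ** C - C ** B) \<bullet> A)\<^sup>2" for B C
  proof -
    have "gl_semidirect_bracket \<rho> (?r *\<^sub>R B, 0) (?r *\<^sub>R C, 0) = ((1 / R) *\<^sub>R (B ** C - C ** B), 0)"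
      using R by (simp add: gl_semidirect_bracket_def matrix_mult.scaleR_left
          matrix_mult.scaleR_right scaleR_diff_right)
    then show ?thesis using R by (simp add: metric_def trace_scaleR trace_commutator ipW_zero)
  qed
  have 2: "?t (?r *\<^sub>R B, 0) (0, u) = (1 / R) * (ipW (\<rho> B u) P)\<^sup>2" if "u \<in> U" for B u
    using R that by (simp add: gl_semidirect_bracket_def metric_def trace_zero W_closed rep_closed
        rep_scale_left ipW_scale_left power_divide)
  have 3: "?t (0, u) (?r *\<^sub>R B, 0) = (1 / R) * (ipW (\<rho> B u) P)\<^sup>2" if "u \<in> U" for B u
    using R that by (simp add: gl_semidirect_bracket_def metric_def trace_zero W_closed rep_closed
        rep_scale_left ipW_scale_left ipW_minus_left power_divide)
  have 4: "?t (unit_scalar, 0) (0, u) = c\<^sup>2 / real CARD('m) * (ipW u P)\<^sup>2" if "u \<in> U" for u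
    using that by (simp add: gl_semidirect_bracket_def metric_def trace_zero W_closed
        rep_unit_scalar ipW_scale_left power_divide power_mult_distrib)
  have 5: "?t (0, u) (unit_scalar, 0) = c\<^sup>2 / real CARD('m) * (ipW u P)\<^sup>2" if "u \<in> U" for u
    using that by (simp add: gl_semidirect_bracket_def metric_def trace_zero W_closed
        rep_unit_scalar ipW_scale_left ipW_minus_left power_divide power_mult_distrib)
  have 6: "?t (unit_scalar, 0) (B, 0) = 0" "?t (B, 0) (unit_scalar, 0) = 0" for B
    by (simp_all add: gl_semidirect_bracket_def metric_def trace_zero unit_scalar_commutes ipW_zero)
  have 7: "?t (0, u) (0, v) = 0" if "u \<in> U" "v \<in> U" for u v
    using that by (simp add: gl_semidirect_bracket_def metric_def trace_zero W_closed ipW_zero)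
  have "(\<Sum>e\<in>frame. \<Sum>f\<in>frame. ?t e f)
     = (\<Sum>B\<in>F. \<Sum>C\<in>F. ((B ** C - C ** B) \<bullet> A)\<^sup>2)
      + (\<Sum>B\<in>F. \<Sum>u\<in>U. (1 / R) * (ipW (\<rho> B u) P)\<^sup>2)
      + (\<Sum>u\<in>U. c\<^sup>2 / real CARD('m) * (ipW u P)\<^sup>2)
      + (\<Sum>u\<in>U. (\<Sum>B\<in>F. (1 / R) * (ipW (\<rho> B u) P)\<^sup>2) + c\<^sup>2 / real CARD('m) * (ipW u P)\<^sup>2)"
    by (simp add: sum_frame sum.distrib 1 2 3 4 5 6 7 del: times_divide_eq_left)
  also have "\<dots> = (\<Sum>B\<in>F. \<Sum>C\<in>F. ((B ** C - C ** B) \<bullet> A)\<^sup>2)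
      + 2 * ((1 / R) * (\<Sum>B\<in>F. \<Sum>u\<in>U. (ipW (\<rho> B u) P)\<^sup>2))
      + 2 * (c\<^sup>2 / real CARD('m) * (\<Sum>u\<in>U. (ipW u P)\<^sup>2))"
    unfolding sum.distrib sum_distrib_left[symmetric]
    by (subst (3) sum.swap) simp
  finally show ?thesis unfolding parseval sum_sl_basis_commutator[OF F] by simp
qed

lemma sum_trace_ad:
  assumes "P \<in> W"
  shows "(\<Sum>e\<in>frame. metric R (gl_semidirect_bracket \<rho> (A, P) e) e) = (\<Sum>u\<in>U. coord u (\<rho> A u))"
proof -
  have "metric R (gl_semidirect_bracket \<rho> (A, P) ((1 / sqrt R) *\<^sub>R B, 0)) ((1 / sqrt R) *\<^sub>R B, 0)
      = (A ** B - B ** A) \<bullet> B" for B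
  proof -
    have "fst (gl_semidirect_bracket \<rho> (A, P) ((1 / sqrt R) *\<^sub>R B, 0)) = (1 / sqrt R) *\<^sub>R (A ** B - B ** A)"
      by (simp add: gl_semidirect_bracket_def matrix_mult.scaleR_left
          matrix_mult.scaleR_right scaleR_diff_right)
    then show ?thesis using R by (simp add: metric_def trace_scaleR trace_commutator ipW_zero)
  qed
  moreover have "metric R (gl_semidirect_bracket \<rho> (A, P) (unit_scalar, 0)) (unit_scalar, 0) = 0"
    by (simp add: gl_semidirect_bracket_def metric_def unit_scalar_commutes trace_zero ipW_zero)
  moreover have "metric R (gl_semidirect_bracket \<rho> (A, P) (0, u)) (0, u) = coord u (\<rho> A u)" if "u \<in> U" for u
    using assms that by (simp add: gl_semidirect_bracket_def metric_def trace_zero ipW_basis)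
  ultimately show ?thesis by (simp add: sum_frame sum_sl_basis_ad[OF F])
qed

end

text \<open>
  The squared Hilbert-Schmidt norm plus the trace of the square of an operator is twice the squared
  norm of its symmetric part; in matrix entries, \<open>a\<^sup>2 + b\<^sup>2 + 2 a b = (a + b)\<^sup>2\<close> for transposed entries.
\<close>

lemma sum_norm_plus_trace_square:
  "(\<Sum>u\<in>U. ipW (\<rho> A u) (\<rho> A u)) + (\<Sum>u\<in>U. ipW (\<rho> A (\<rho> A u)) u)
    = (1/2) * (\<Sum>u\<in>U. \<Sum>v\<in>U. (coord v (\<rho> A u) + coord u (\<rho> A v))\<^sup>2)"
proof -
  let ?a = "\<lambda>u v. coord v (\<rho> A u)"
  have "ipW (\<rho> A (\<rho> A u)) u = (\<Sum>v\<in>U. ?a u v * ?a v u)" if u: "u \<in> U" for u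
  proof -
    have inW: "(\<Sum>v\<in>V. ?a u v *\<^sub>R v) \<in> W" if "V \<subseteq> U" for V
      using that W_closed by (intro subspace_sum[OF W_subspace]) auto
    have "coord u (\<rho> A (\<Sum>v\<in>V. ?a u v *\<^sub>R v)) = (\<Sum>v\<in>V. ?a u v * ?a v u)" if "V \<subseteq> U" for V
    proof -
      have "finite V" using that finite_U finite_subset by blast
      then show ?thesis using that
      proof (induction V rule: finite_induct)
        case empty
        then show ?case using coord_scale[where P = 0 and u = u and r = 0] W_closed by simp
      next
        case (insert v V)
        then show ?case
          using inW[of V] by (simp add: rep_add_right rep_scale_right coord_add coord_scale W_closed rep_closed)
      qed
    qed
    from this[OF subset_refl] show ?thesis
      using u coord_expansion[of "\<rho> A u"] by (simp add: ipW_basis W_closed rep_closed)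
  qed
  then have "(\<Sum>u\<in>U. ipW (\<rho> A (\<rho> A u)) u) = (\<Sum>u\<in>U. \<Sum>v\<in>U. ?a u v * ?a v u)" by simp
  moreover have "(\<Sum>u\<in>U. ipW (\<rho> A u) (\<rho> A u)) = (\<Sum>u\<in>U. \<Sum>v\<in>U. (?a u v)\<^sup>2)"
    by (simp add: ipW_def power2_eq_square)
  moreover have "(\<Sum>u\<in>U. \<Sum>v\<in>U. (?a v u)\<^sup>2) = (\<Sum>u\<in>U. \<Sum>v\<in>U. (?a u v)\<^sup>2)"
    by (rule sum.swap)
  moreover have "(\<Sum>u\<in>U. \<Sum>v\<in>U. (?a u v + ?a v u)\<^sup>2)
      = (\<Sum>u\<in>U. \<Sum>v\<in>U. (?a u v)\<^sup>2) + (\<Sum>u\<in>U. \<Sum>v\<in>U. (?a v u)\<^sup>2)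
        + 2 * (\<Sum>u\<in>U. \<Sum>v\<in>U. ?a u v * ?a v u)"
    by (simp add: power2_sum sum.distrib sum_distrib_left mult.assoc)
  ultimately show ?thesis by simp
qed

text \<open>
  Adding a scalar \<open>k\<close> to a traceless operator produces no mixed term, because the mixed term is
  proportional to the trace.
\<close>

lemma sum_symmetrized_shift:
  fixes b :: "'w \<Rightarrow> 'w \<Rightarrow> real" and k :: real
  assumes tr: "(\<Sum>u\<in>U. b u u) = 0"
  shows "(\<Sum>u\<in>U. \<Sum>v\<in>U. ((if u = v then k else 0) + b u v + ((if v = u then k else 0) + b v u))\<^sup>2)
    = (\<Sum>u\<in>U. \<Sum>v\<in>U. (b u v + b v u)\<^sup>2) + 4 * k\<^sup>2 * real (card U)"
proof -
  have "((if u = v then k else 0) + b u v + ((if v = u then k else 0) + b v u))\<^sup>2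
      = (b u v + b v u)\<^sup>2 + (if v = u then 4 * k\<^sup>2 + 8 * k * b u u else 0)" for u v
    by (simp add: power2_eq_square algebra_simps)
  then have "(\<Sum>u\<in>U. \<Sum>v\<in>U. ((if u = v then k else 0) + b u v + ((if v = u then k else 0) + b v u))\<^sup>2)
      = (\<Sum>u\<in>U. \<Sum>v\<in>U. (b u v + b v u)\<^sup>2) + (\<Sum>u\<in>U. 4 * k\<^sup>2 + 8 * k * b u u)"
    using finite_U by (simp add: sum.distrib)
  also have "(\<Sum>u\<in>U. 4 * k\<^sup>2 + 8 * k * b u u) = 4 * k\<^sup>2 * real (card U) + 8 * k * (\<Sum>u\<in>U. b u u)"
    by (simp add: sum.distrib sum_distrib_left)
  finally show ?thesis using tr by simp
qed

text \<open>
  The positivity hypothesis concerns the traceless matrices only, and neither it nor the trace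
  hypothesis involves \<open>R\<close>.  Hence \<open>R\<close> can be chosen last, to suppress the terms by which the traceless
  matrices could make the Ricci form positive on \<open>W\<close>.
\<close>

theorem admits_negative_ricci_semidirect:
  assumes c: "c \<noteq> 0" and ne: "U \<noteq> {}"
    and tr: "\<And>A. trace A = 0 \<Longrightarrow> (\<Sum>u\<in>U. coord u (\<rho> A u)) = 0"
    and pos: "\<And>A. trace A = 0 \<Longrightarrow> A \<noteq> 0 \<Longrightarrow>
      0 < real CARD('m) / 2 * (A \<bullet> A) + real CARD('m) * trace (A ** A)
        + (1/4) * (\<Sum>u\<in>U. \<Sum>v\<in>U. (coord v (\<rho> A u) + coord u (\<rho> A v))\<^sup>2)"
  shows "admits_negative_ricci (UNIV \<times> W) (gl_semidirect_bracket \<rho>)"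
proof -
  let ?m = "real CARD('m)" and ?d = "real (card U)"
  obtain F :: "(real^'m^'m) set" where F: "sl_basis F" using ex_sl_basis by blast
  \<comment> \<open>By Cauchy-Schwarz, \<open>K / (2 R)\<close> times \<open>|P|\<^sup>2\<close> bounds the only positive term in \<open>P\<close>.\<close>
  define K where "K = (\<Sum>B\<in>F. \<Sum>u\<in>U. ipW (\<rho> B u) (\<rho> B u))"
  have K: "K \<ge> 0" by (simp add: K_def sum_nonneg ipW_nonneg)
  have d: "?d > 0" using ne finite_U by (simp add: card_gt_0_iff)
  have c2d: "c\<^sup>2 * ?d > 0" using c d by simp
  define R where "R = K * ?m / (c\<^sup>2 * ?d) + 1"
  have "K * ?m / (c\<^sup>2 * ?d) \<ge> 0" using K c2d by (intro divide_nonneg_nonneg) auto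
  then have R: "R > 0" by (simp add: R_def)
  have "K * ?m < R * (c\<^sup>2 * ?d)"
    using c2d c d by (simp add: R_def distrib_right)
  then have dominates: "K / R < c\<^sup>2 * ?d / ?m"
    using R by (simp add: field_simps)
  interpret M: metric_lie_algebra "UNIV \<times> W" "gl_semidirect_bracket \<rho>" "metric R"
    by (rule metric_lie_algebra_semidirect[OF R])
  note E = frame_orthonormal[OF R F]
  define s where "s = (\<lambda>A :: real^'m^'m. trace A / ?m)"
  define A0 where "A0 = (\<lambda>A :: real^'m^'m. A - s A *\<^sub>R mat 1)"
  have trA0: "trace (A0 A) = 0" for A
    by (simp add: A0_def s_def trace_sub trace_scaleR trace_mat_1)
  have rep: "\<rho> A u = (c * s A) *\<^sub>R u + \<rho> (A0 A) u" if "u \<in> W" for A u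
    using that by (simp add: A0_def rep_diff_left rep_scale_left rep_mat_1)
  have coord_rep: "coord v (\<rho> A u) = (if u = v then c * s A else 0) + coord v (\<rho> (A0 A) u)"
    if "u \<in> U" "v \<in> U" for A u v
    using that rep[of u A]
    by (simp add: coord_add coord_scale coord_basis W_closed rep_closed)
  \<comment> \<open>Chosen so that its inner product with \<open>(A, P)\<close> is \<open>c d tr A / m\<close>, the trace of the action of \<open>A\<close> on \<open>W\<close>.\<close>
  define H :: "(real^'m^'m) \<times> 'w" where "H = ((c * ?d / ?m) *\<^sub>R mat 1, 0)"
  have HL: "H \<in> UNIV \<times> W" using W_closed by (simp add: H_def)
  have Htr: "\<forall>X \<in> UNIV \<times> W.
      metric R H X = (\<Sum>e\<in>frame R F. metric R (gl_semidirect_bracket \<rho> X e) e)"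
  proof
    fix X :: "(real^'m^'m) \<times> 'w" assume "X \<in> UNIV \<times> W"
    then obtain A P where X: "X = (A, P)" and P: "P \<in> W" by auto
    have "metric R H X = c * ?d * s A"
      by (simp add: X H_def metric_def ipW_zero trace_scaleR trace_mat_1 s_def
          inner_commute[of "mat 1"] inner_mat_1 algebra_simps diff_divide_distrib)
    moreover have "(\<Sum>u\<in>U. coord u (\<rho> A u)) = c * ?d * s A"
      using tr[OF trA0, of A] by (simp add: coord_rep[where A = A] sum.distrib)
    ultimately show "metric R H X = (\<Sum>e\<in>frame R F. metric R (gl_semidirect_bracket \<rho> X e) e)"
      unfolding X sum_trace_ad[OF R F P] by simp
  qed
  have "metric R (M.ricci_op X) X < 0" if X: "X \<in> UNIV \<times> W" "X \<noteq> 0" for X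
  proof -
    obtain A P where XAP: "X = (A, P)" and P: "P \<in> W" using X(1) by auto
    let ?b = "\<lambda>u v. coord v (\<rho> (A0 A) u)"
    define SB where "SB = (\<Sum>u\<in>U. \<Sum>v\<in>U. (?b u v + ?b v u)\<^sup>2)"
    define Q where "Q = ?m / 2 * (A0 A \<bullet> A0 A) + ?m * trace (A0 A ** A0 A) + (1/4) * SB"
    define S1 where "S1 = (\<Sum>B\<in>F. ipW (\<rho> B P) (\<rho> B P))"
    define S2 where "S2 = (\<Sum>B\<in>F. \<Sum>u\<in>U. (ipW (\<rho> B u) P)\<^sup>2)"
    have bracket_H: "metric R (gl_semidirect_bracket \<rho> H (A, P)) (A, P) = c\<^sup>2 * ?d / ?m * ipW P P"
      using P by (simp add: H_def gl_semidirect_bracket_def metric_def trace_zero rep_scale_left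
          rep_mat_1 ipW_scale_left W_closed matrix_mult.scaleR_left matrix_mult.scaleR_right
          power2_eq_square)
    have T: "(\<Sum>u\<in>U. ipW (\<rho> A u) (\<rho> A u)) + (\<Sum>u\<in>U. ipW (\<rho> A (\<rho> A u)) u)
        = (1/2) * SB + 2 * (c * s A)\<^sup>2 * ?d"
      unfolding SB_def sum_norm_plus_trace_square
      using sum_symmetrized_shift[of ?b "c * s A", OF tr[OF trA0]] by (simp add: coord_rep[where A = A])
    have A_eq: "A = s A *\<^sub>R mat 1 + A0 A" by (simp add: A0_def)
    have trA: "trace A = s A * ?m" by (simp add: s_def)
    have normA: "A \<bullet> A = A0 A \<bullet> A0 A + (s A)\<^sup>2 * ?m"
      by (subst (1 2) A_eq) (simp add: inner_add_left inner_add_right inner_mat_1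
          inner_commute[of "mat 1"] trace_add trace_scaleR trA0 trace_mat_1 power2_eq_square)
    have trAA: "trace (A ** A) = trace (A0 A ** A0 A) + (s A)\<^sup>2 * ?m"
      by (subst (1 2) A_eq) (simp add: matrix_mult.add_left matrix_mult.add_right trace_add
          matrix_mult.scaleR_left matrix_mult.scaleR_right trace_scaleR trA0 trace_mat_1 power2_eq_square)
    have ricci: "metric R (M.ricci_op X) X = - Q - (c * s A)\<^sup>2 * ?d
        - (1 / (2 * R)) * S1 + (1 / (2 * R)) * S2 - c\<^sup>2 * ?d / ?m * ipW P P"
    proof -
      define HS where "HS = (\<Sum>u\<in>U. ipW (\<rho> A u) (\<rho> A u))"
      define KT where "KT = (\<Sum>u\<in>U. ipW (\<rho> A (\<rho> A u)) u)"
      have HS: "HS = (1/2) * SB + 2 * (c * s A)\<^sup>2 * ?d - KT"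
        using T unfolding HS_def KT_def by linarith
      note ricci = M.ricci_form[OF E HL Htr X(1), unfolded XAP sum_norm_ad[OF R F P]
          sum_killing[OF R F P] sum_bracket_component[OF R F P] bracket_H,
          folded HS_def KT_def S1_def S2_def, unfolded normA trAA trA, folded XAP]
      show ?thesis unfolding ricci HS Q_def
        by (simp add: power2_eq_square algebra_simps)
    qed
    have S1: "S1 \<ge> 0" by (simp add: S1_def sum_nonneg ipW_nonneg)
    have "S2 \<le> (\<Sum>B\<in>F. \<Sum>u\<in>U. ipW (\<rho> B u) (\<rho> B u) * ipW P P)"
      unfolding S2_def by (intro sum_mono ipW_Cauchy_Schwarz)
    then have S2: "S2 \<le> K * ipW P P" by (simp add: K_def sum_distrib_right)
    have Q: "Q \<ge> 0" "A0 A \<noteq> 0 \<Longrightarrow> Q > 0"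
      using pos[OF trA0, of A] unfolding Q_def SB_def
      by (cases "A0 A = 0"; force simp: trace_zero matrix_mult.zero_left intro!: sum_nonneg)+
    have "(1 / (2 * R)) * S2 \<le> (1 / (2 * R)) * (K * ipW P P)"
      using S2 R by (intro mult_left_mono) auto
    also have "\<dots> = (1/2) * (K / R) * ipW P P" by simp
    finally have PP: "(1 / (2 * R)) * S2 - c\<^sup>2 * ?d / ?m * ipW P P
        \<le> - ((c\<^sup>2 * ?d / ?m - (1/2) * (K / R)) * ipW P P)"
      by (simp add: algebra_simps)
    define Z where "Z = (c\<^sup>2 * ?d / ?m - (1/2) * (K / R)) * ipW P P"
    define s2 where "s2 = (c * s A)\<^sup>2 * ?d"
    have "0 \<le> (1 / (2 * R)) * S1" using S1 R by simp
    then have le: "metric R (M.ricci_op X) X \<le> - Q - s2 - Z"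
      using PP unfolding ricci Z_def[symmetric] s2_def[symmetric] by simp
    have coef: "c\<^sup>2 * ?d / ?m - (1/2) * (K / R) > 0"
    proof -
      have "0 \<le> K / R" using K R by simp
      then show ?thesis using dominates by linarith
    qed
    have Z: "0 \<le> Z" "P \<noteq> 0 \<Longrightarrow> 0 < Z"
      using coef ipW_nonneg[of P] ipW_pos[OF P] by (simp_all add: Z_def)
    have s2: "0 \<le> s2" "s A \<noteq> 0 \<Longrightarrow> 0 < s2" using c d by (simp_all add: s2_def)
    consider "A0 A \<noteq> 0" | "A0 A = 0" "s A \<noteq> 0" | "P \<noteq> 0"
      using X(2) XAP A_eq by (cases "A0 A = 0"; cases "s A = 0"; cases "P = 0") (auto simp: zero_prod_def)
    then show ?thesis
      by cases (use le Q Z s2 in linarith)+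
  qed
  then have "M.negative_ricci_curvature" unfolding M.negative_ricci_curvature_def by blast
  then show ?thesis
    unfolding admits_negative_ricci_def using M.metric_lie_algebra_axioms by blast
qed

end

section \<open>The action on polynomial functions\<close>

lemma matrix_power_scaleR:
  "((**) (r *\<^sub>R X) ^^ k) (mat 1) = r ^ k *\<^sub>R ((**) X ^^ k) (mat 1)" for X :: "real^'m^'m"
proof (induction k)
  case (Suc k)
  then show ?case
    by (simp add: matrix_mult.scaleR_left matrix_mult.scaleR_right mult.commute)
qed simp

lemma matrix_power_bound:
  fixes X :: "real^'m^'m"
  shows
  "\<exists>K. \<forall>k. norm (((**) X ^^ k) (mat 1 :: real^'m^'m)) \<le> K ^ k * norm (mat 1 :: real^'m^'m)"
proof -
  obtain K where K: "K > 0" "\<And>B :: real^'m^'m. norm (X ** B) \<le> norm B * K"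
    using bounded_linear.pos_bounded[OF matrix_mult.bounded_linear_right] by blast
  have "norm (((**) X ^^ k) (mat 1 :: real^'m^'m)) \<le> K ^ k * norm (mat 1 :: real^'m^'m)" for k
  proof (induction k)
    case (Suc k)
    have "norm (((**) X ^^ Suc k) (mat 1 :: real^'m^'m)) \<le> K * norm (((**) X ^^ k) (mat 1 :: real^'m^'m))"
      using K(2) by (simp add: mult.commute)
    also have "\<dots> \<le> K * (K ^ k * norm (mat 1 :: real^'m^'m))"
      using Suc K(1) by (intro mult_left_mono) auto
    finally show ?case by (simp add: mult.assoc)
  qed simp
  then show ?thesis by blast
qed

lemma summable_matrix_exp:
  fixes X :: "real^'m^'m"
  shows "summable (\<lambda>k. (1 / fact k) *\<^sub>R (((**) X ^^ k) (mat 1 :: real^'m^'m)))"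
proof -
  obtain K where K: "\<And>k. norm (((**) X ^^ k) (mat 1 :: real^'m^'m)) \<le> K ^ k * norm (mat 1 :: real^'m^'m)"
    using matrix_power_bound by blast
  have "summable (\<lambda>k. (inverse (fact k) * K ^ k) * norm (mat 1 :: real^'m^'m))"
    by (intro summable_mult2 summable_exp)
  moreover have "norm ((1 / fact k) *\<^sub>R (((**) X ^^ k) (mat 1 :: real^'m^'m)))
      \<le> (inverse (fact k) * K ^ k) * norm (mat 1 :: real^'m^'m)" for k
    using K[of k] by (simp add: divide_simps mult_ac)
  ultimately show ?thesis by (rule summable_comparison_test')
qed

lemma matrix_exp_entry:
  fixes X :: "real^'m^'m"
  defines "a \<equiv> \<lambda>i j k. (1 / fact k) * ((-1) ^ k * ((((**) X ^^ k) (mat 1)) $ i $ j))"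
  shows "summable (\<lambda>k. a i j k * t ^ k)" "matrix_exp (- t *\<^sub>R X) $ i $ j = (\<Sum>k. a i j k * t ^ k)"
proof -
  have lin: "bounded_linear (\<lambda>A :: real^'m^'m. A $ i $ j)"
    by (rule bounded_linear_compose[OF bounded_linear_vec_nth[of j] bounded_linear_vec_nth[of i]])
  have "((1 / fact k) *\<^sub>R (((**) (- t *\<^sub>R X) ^^ k) (mat 1))) $ i $ j = a i j k * t ^ k" for k
    unfolding matrix_power_scaleR by (simp add: a_def power_minus[of t])
  then show "summable (\<lambda>k. a i j k * t ^ k)" "matrix_exp (- t *\<^sub>R X) $ i $ j = (\<Sum>k. a i j k * t ^ k)"
    using bounded_linear.summable[OF lin summable_matrix_exp[of "- t *\<^sub>R X"]]
      bounded_linear.suminf[OF lin summable_matrix_exp[of "- t *\<^sub>R X"]]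
    by (simp_all add: matrix_exp_def)
qed

lemma matrix_exp_zero: "matrix_exp (0 :: real^'m^'m) = mat 1"
proof -
  have "matrix_exp (- 0 *\<^sub>R (0 :: real^'m^'m)) $ i $ j = mat 1 $ i $ j" for i j
    unfolding matrix_exp_entry(2) powser_zero by simp
  then show ?thesis by (simp add: vec_eq_iff)
qed

text \<open>
  Each entry of the exponential is a power series in \<open>t\<close> with infinite radius of convergence, whose
  linear coefficient is the entry of \<open>- X\<close>.
\<close>

lemma matrix_exp_has_derivative:
  "((\<lambda>t. matrix_exp (- t *\<^sub>R X) $ i $ j) has_real_derivative - X $ i $ j) (at 0)"
  for X :: "real^'m^'m"
proof -
  define a where "a = (\<lambda>k. (1 / fact k) * ((-1) ^ k * ((((**) X ^^ k) (mat 1)) $ i $ j)))"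
  have summable: "summable (\<lambda>k. a k * 1 ^ k)"
    unfolding a_def by (rule matrix_exp_entry(1))
  have "((\<lambda>t. \<Sum>k. a k * t ^ k) has_real_derivative (\<Sum>k. diffs a k * 0 ^ k)) (at 0)"
    by (rule termdiffs_strong[OF summable]) simp
  moreover have "(\<Sum>k. diffs a k * 0 ^ k) = diffs a 0" by (rule powser_zero)
  moreover have "diffs a 0 = a (Suc 0)" by (simp add: diffs_def)
  moreover have "a (Suc 0) = - X $ i $ j" by (simp add: a_def)
  moreover have "(\<lambda>t. matrix_exp (- t *\<^sub>R X) $ i $ j) = (\<lambda>t. \<Sum>k. a k * t ^ k)"
    unfolding a_def by (rule ext) (rule matrix_exp_entry(2))
  ultimately show ?thesis by (simp only:)
qed

text \<open>
  Polynomial functions as the algebra generated by the coordinates.  The infinitesimal action is a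
  derivation of this algebra, so identities between such operators need checking on coordinates only.
\<close>

inductive polynomial_map :: "((complex ^ 'm) \<Rightarrow> complex) \<Rightarrow> bool" where
  const: "polynomial_map (\<lambda>z. a)"
| coord: "polynomial_map (\<lambda>z. z $ i)"
| add: "polynomial_map P \<Longrightarrow> polynomial_map Q \<Longrightarrow> polynomial_map (\<lambda>z. P z + Q z)"
| mult: "polynomial_map P \<Longrightarrow> polynomial_map Q \<Longrightarrow> polynomial_map (\<lambda>z. P z * Q z)"

definition exp_curve :: "real^'m^'m \<Rightarrow> complex^'m \<Rightarrow> real \<Rightarrow> complex^'m" where
  "exp_curve X z t = map_matrix complex_of_real (matrix_exp (- t *\<^sub>R X)) *v z"

lemma exp_curve_zero: "exp_curve X z 0 = z" for X :: "real^'m^'m"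
proof -
  have "map_matrix complex_of_real (mat 1) = (mat 1 :: complex^'m^'m)"
    by (simp add: vec_eq_iff mat_def map_matrix_def)
  then show ?thesis by (simp add: exp_curve_def matrix_exp_zero)
qed

lemma exp_curve_coord_derivative:
  "((\<lambda>t. exp_curve X z t $ i) has_vector_derivative - (\<Sum>j\<in>UNIV. X $ i $ j *\<^sub>R z $ j)) (at 0)"
proof -
  have "((\<lambda>t. (matrix_exp (- t *\<^sub>R X) $ i $ j) *\<^sub>R z $ j)
      has_vector_derivative (- X $ i $ j) *\<^sub>R z $ j) (at 0)" for j
    using has_vector_derivative_scaleR[OF matrix_exp_has_derivative[of X i j]
        has_vector_derivative_const[of "z $ j"]] by simp
  then have "((\<lambda>t. \<Sum>j\<in>UNIV. (matrix_exp (- t *\<^sub>R X) $ i $ j) *\<^sub>R z $ j)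
      has_vector_derivative (\<Sum>j\<in>UNIV. (- X $ i $ j) *\<^sub>R z $ j)) (at 0)"
    by (intro has_vector_derivative_sum)
  moreover have "(\<lambda>t. exp_curve X z t $ i) = (\<lambda>t. \<Sum>j\<in>UNIV. (matrix_exp (- t *\<^sub>R X) $ i $ j) *\<^sub>R z $ j)"
    by (simp add: exp_curve_def matrix_vector_mult_def map_matrix_def scaleR_conv_of_real)
  ultimately show ?thesis by (simp add: sum_negf)
qed

lemma poly_rep_eqI:
  "(\<And>z. ((\<lambda>t. P (exp_curve X z t)) has_vector_derivative D z) (at 0)) \<Longrightarrow> poly_rep X P = D"
  unfolding poly_rep_def exp_curve_def by (intro ext vector_derivative_at)

lemma poly_rep_derivative:
  assumes "polynomial_map P"
  shows "((\<lambda>t. P (exp_curve X z t)) has_vector_derivative poly_rep X P z) (at 0)"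
proof -
  have "\<exists>d. ((\<lambda>t. P (exp_curve X z t)) has_vector_derivative d) (at 0)" using assms
  proof induction
    case (coord i)
    then show ?case using exp_curve_coord_derivative by blast
  next
    case (add P Q)
    then obtain p q where "((\<lambda>t. P (exp_curve X z t)) has_vector_derivative p) (at 0)"
      "((\<lambda>t. Q (exp_curve X z t)) has_vector_derivative q) (at 0)" by blast
    from has_vector_derivative_add[OF this] show ?case by blast
  next
    case (mult P Q)
    then obtain p q where "((\<lambda>t. P (exp_curve X z t)) has_vector_derivative p) (at 0)"
      "((\<lambda>t. Q (exp_curve X z t)) has_vector_derivative q) (at 0)" by blast
    from has_vector_derivative_mult[OF this] show ?case by blast
  qed (blast intro: has_vector_derivative_const)
  then show ?thesis unfolding poly_rep_def exp_curve_def by (metis vector_derivative_works differentiableI_vector)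
qed

lemma poly_rep_const: "poly_rep X (\<lambda>z. a) = (\<lambda>z. 0)"
  by (rule poly_rep_eqI) (rule has_vector_derivative_const)

lemma poly_rep_coord: "poly_rep X (\<lambda>z. z $ i) = (\<lambda>z. - (\<Sum>j\<in>UNIV. X $ i $ j *\<^sub>R z $ j))"
  by (rule poly_rep_eqI) (rule exp_curve_coord_derivative)

lemma poly_rep_add:
  "polynomial_map P \<Longrightarrow> polynomial_map Q \<Longrightarrow>
    poly_rep X (\<lambda>z. P z + Q z) = (\<lambda>z. poly_rep X P z + poly_rep X Q z)"
  by (rule poly_rep_eqI) (intro has_vector_derivative_add poly_rep_derivative)

lemma poly_rep_mult:
  assumes "polynomial_map P" "polynomial_map Q"
  shows "poly_rep X (\<lambda>z. P z * Q z) = (\<lambda>z. P z * poly_rep X Q z + poly_rep X P z * Q z)"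
proof (rule poly_rep_eqI)
  fix z
  show "((\<lambda>t. P (exp_curve X z t) * Q (exp_curve X z t)) has_vector_derivative
      P z * poly_rep X Q z + poly_rep X P z * Q z) (at 0)"
    using has_vector_derivative_mult[OF poly_rep_derivative[OF assms(1), of X z]
        poly_rep_derivative[OF assms(2), of X z]]
    by (simp add: exp_curve_zero)
qed

lemma poly_rep_cmult:
  "polynomial_map P \<Longrightarrow> poly_rep X (\<lambda>z. a * P z) = (\<lambda>z. a * poly_rep X P z)"
  by (simp add: poly_rep_mult polynomial_map.const poly_rep_const)

lemma polynomial_map_sum:
  "(\<And>i. i \<in> I \<Longrightarrow> polynomial_map (P i)) \<Longrightarrow> polynomial_map (\<lambda>z. \<Sum>i\<in>I. P i z)"
  by (induction I rule: infinite_finite_induct)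
    (auto intro: polynomial_map.const polynomial_map.add)

lemma polynomial_map_prod:
  "(\<And>i. i \<in> I \<Longrightarrow> polynomial_map (P i)) \<Longrightarrow> polynomial_map (\<lambda>z. \<Prod>i\<in>I. P i z)"
  by (induction I rule: infinite_finite_induct)
    (auto intro: polynomial_map.const polynomial_map.mult)

lemma polynomial_map_power: "polynomial_map P \<Longrightarrow> polynomial_map (\<lambda>z. P z ^ k)"
  by (induction k) (auto intro: polynomial_map.const polynomial_map.mult)

lemma poly_rep_sum:
  "(\<And>i. i \<in> I \<Longrightarrow> polynomial_map (P i)) \<Longrightarrow>
    poly_rep X (\<lambda>z. \<Sum>i\<in>I. P i z) = (\<lambda>z. \<Sum>i\<in>I. poly_rep X (P i) z)"
  by (induction I rule: infinite_finite_induct)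
    (simp_all add: poly_rep_const poly_rep_add polynomial_map_sum)

lemma poly_rep_linear_form:
  fixes X :: "real^'m^'m"
  shows "poly_rep X (\<lambda>z. - (\<Sum>j\<in>UNIV. a j *\<^sub>R z $ j))
    = (\<lambda>z. \<Sum>j\<in>UNIV. \<Sum>k\<in>UNIV. (a j * X $ j $ k) *\<^sub>R z $ k)"
proof -
  have "(\<lambda>z :: complex^'m. - (\<Sum>j\<in>UNIV. a j *\<^sub>R z $ j)) = (\<lambda>z. \<Sum>j\<in>UNIV. - of_real (a j) * z $ j)"
    by (simp add: scaleR_conv_of_real sum_negf)
  moreover have "poly_rep X (\<lambda>z. \<Sum>j\<in>UNIV. - of_real (a j) * z $ j)
      = (\<lambda>z. \<Sum>j\<in>UNIV. - of_real (a j) * poly_rep X (\<lambda>z. z $ j) z)"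
    by (subst poly_rep_sum) (auto intro: polynomial_map.intros
        simp only: poly_rep_cmult[OF polynomial_map.coord])
  ultimately show ?thesis
    by (simp add: poly_rep_coord scaleR_conv_of_real sum_distrib_left sum_negf mult.assoc)
qed

lemma polynomial_map_poly_rep: "polynomial_map P \<Longrightarrow> polynomial_map (poly_rep X P)" for X :: "real^'m^'m"
proof (induction rule: polynomial_map.induct)
  case (coord i)
  have "(\<lambda>z :: complex^'m. - (\<Sum>j\<in>UNIV. X $ i $ j *\<^sub>R z $ j)) = (\<lambda>z. \<Sum>j\<in>UNIV. - of_real (X $ i $ j) * z $ j)"
    by (simp add: scaleR_conv_of_real sum_negf)
  then show ?case
    unfolding poly_rep_coord by (simp only:) (intro polynomial_map_sum polynomial_map.intros)
qed (auto simp: poly_rep_const poly_rep_add poly_rep_mult intro: polynomial_map.intros)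

lemma poly_rep_add_left:
  "polynomial_map P \<Longrightarrow> poly_rep (X + Y) P = (\<lambda>z. poly_rep X P z + poly_rep Y P z)"
proof (induction rule: polynomial_map.induct)
  case (coord i)
  show ?case by (simp add: poly_rep_coord scaleR_add_left sum.distrib)
qed (simp_all add: poly_rep_const poly_rep_add poly_rep_mult algebra_simps)

lemma poly_rep_scale_left:
  "polynomial_map P \<Longrightarrow> poly_rep (r *\<^sub>R X) P = (\<lambda>z. r *\<^sub>R poly_rep X P z)"
proof (induction rule: polynomial_map.induct)
  case (coord i)
  show ?case by (simp add: poly_rep_coord scaleR_sum_right)
qed (simp_all add: poly_rep_const poly_rep_add poly_rep_mult algebra_simps)

text \<open>
  The commutator of two derivations is a derivation, so it suffices to compare both sides on
  coordinate functions, where the action is the matrix action on linear forms.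
\<close>

lemma poly_rep_commutator:
  assumes "polynomial_map P"
  shows "poly_rep (X ** Y - Y ** X) P
    = (\<lambda>z. poly_rep X (poly_rep Y P) z - poly_rep Y (poly_rep X P) z)"
  using assms
proof induction
  case (const a)
  then show ?case by (simp add: poly_rep_const)
next
  case (coord i)
  have "(\<Sum>j\<in>UNIV. (X ** Y) $ i $ j *\<^sub>R z $ j) = (\<Sum>j\<in>UNIV. \<Sum>k\<in>UNIV. (X $ i $ j * Y $ j $ k) *\<^sub>R z $ k)"
    for X Y :: "real^'a^'a" and z :: "complex^'a"
    by (simp add: matrix_matrix_mult_def scaleR_sum_left, rule sum.swap)
  then show ?case
    by (simp add: poly_rep_coord poly_rep_linear_form scaleR_diff_left sum_subtractf)
next
  case (add P Q)
  then show ?case by (simp add: poly_rep_add polynomial_map_poly_rep algebra_simps)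
next
  case (mult P Q)
  then show ?case
    by (simp add: poly_rep_add poly_rep_mult polynomial_map_poly_rep polynomial_map.mult algebra_simps)
qed

section \<open>Monomials\<close>

definition monomial :: "('m \<Rightarrow> nat) \<Rightarrow> (complex ^ 'm) \<Rightarrow> complex" where
  "monomial \<alpha> z = (\<Prod>i\<in>UNIV. (z $ i) ^ \<alpha> i)"

definition exponents :: "nat \<Rightarrow> ('m::finite \<Rightarrow> nat) set" where
  "exponents n = {\<alpha>. (\<Sum>i\<in>UNIV. \<alpha> i) = n}"

text \<open>
  The exponent of \<open>z_j\<close> times the derivative of \<open>z\<^sup>\<alpha>\<close> with respect to \<open>z_i\<close>.  If \<open>\<alpha> i = 0\<close>, truncated
  subtraction yields an exponent of too high a degree, which is harmless because it is always
  accompanied by the coefficient \<open>\<alpha> i\<close>.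
\<close>

definition shift :: "'m \<Rightarrow> 'm \<Rightarrow> ('m \<Rightarrow> nat) \<Rightarrow> 'm \<Rightarrow> nat" where
  "shift i j \<alpha> = (\<lambda>k. (if k = i then \<alpha> i - 1 else \<alpha> k) + (if k = j then 1 else 0))"

lemma polynomial_map_monomial: "polynomial_map (monomial \<alpha>)"
  unfolding monomial_def
  by (intro polynomial_map_prod polynomial_map_power polynomial_map.coord)

lemma monomial_shift:
  "monomial (shift i j \<alpha>) z = (z $ i) ^ (\<alpha> i - 1) * (\<Prod>k\<in>UNIV - {i}. (z $ k) ^ \<alpha> k) * z $ j"
proof -
  have "monomial (shift i j \<alpha>) z
      = (\<Prod>k\<in>UNIV. (z $ k) ^ (if k = i then \<alpha> i - 1 else \<alpha> k)) * (\<Prod>k\<in>UNIV. (z $ k) ^ (if k = j then 1 else 0))"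
    unfolding monomial_def shift_def by (simp only: power_add prod.distrib)
  also have "(\<Prod>k\<in>UNIV. (z $ k) ^ (if k = j then 1 else 0)) = (\<Prod>k\<in>UNIV. if k = j then z $ k else 1)"
    by (intro prod.cong refl) simp
  also have "\<dots> = z $ j" by simp
  also have "(\<Prod>k\<in>UNIV. (z $ k) ^ (if k = i then \<alpha> i - 1 else \<alpha> k))
      = (z $ i) ^ (\<alpha> i - 1) * (\<Prod>k\<in>UNIV - {i}. (z $ k) ^ \<alpha> k)"
    by (subst prod.remove[of _ i]) (auto intro!: prod.cong)
  finally show ?thesis .
qed

lemma poly_rep_power:
  assumes "polynomial_map P"
  shows "poly_rep X (\<lambda>z. P z ^ k) = (\<lambda>z. of_nat k * P z ^ (k - 1) * poly_rep X P z)"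
proof (induction k)
  case (Suc k)
  then show ?case
    by (cases k) (simp_all add: poly_rep_mult assms polynomial_map_power polynomial_map.mult algebra_simps)
qed (simp add: poly_rep_const)

lemma poly_rep_prod:
  assumes "finite I" "\<And>i. i \<in> I \<Longrightarrow> polynomial_map (P i)"
  shows "poly_rep X (\<lambda>z. \<Prod>i\<in>I. P i z) = (\<lambda>z. \<Sum>i\<in>I. poly_rep X (P i) z * (\<Prod>k\<in>I - {i}. P k z))"
  using assms
proof (induction I rule: finite_induct)
  case empty
  then show ?case by (simp add: poly_rep_const)
next
  case (insert j I)
  have "(\<Prod>k\<in>insert j I - {i}. P k z) = P j z * (\<Prod>k\<in>I - {i}. P k z)" if "i \<in> I" for i z
  proof -
    have "insert j I - {i} = insert j (I - {i})" using that insert by auto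
    then show ?thesis using insert by simp
  qed
  moreover have "(\<Prod>k\<in>insert j I - {j}. P k z) = (\<Prod>k\<in>I. P k z)" for z
    using insert by simp
  ultimately show ?case
    using insert by (simp add: poly_rep_mult polynomial_map_prod sum_distrib_left mult_ac add.commute)
qed

lemma poly_rep_monomial:
  fixes X :: "real^'m^'m"
  shows "poly_rep X (monomial \<alpha>)
    = (\<lambda>z. \<Sum>i\<in>UNIV. \<Sum>j\<in>UNIV. (- X $ i $ j * real (\<alpha> i)) *\<^sub>R monomial (shift i j \<alpha>) z)"
proof
  fix z :: "complex^'m"
  have "poly_rep X (monomial \<alpha>) z
      = (\<Sum>i\<in>UNIV. poly_rep X (\<lambda>z. z $ i ^ \<alpha> i) z * (\<Prod>k\<in>UNIV - {i}. z $ k ^ \<alpha> k))"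
    unfolding monomial_def
    by (subst poly_rep_prod) (auto intro: polynomial_map_power polynomial_map.coord)
  also have "\<dots> = (\<Sum>i\<in>UNIV. \<Sum>j\<in>UNIV. (- X $ i $ j * real (\<alpha> i)) *\<^sub>R monomial (shift i j \<alpha>) z)"
    by (simp add: poly_rep_power polynomial_map.coord poly_rep_coord monomial_shift
        sum_distrib_left sum_distrib_right sum_negf scaleR_conv_of_real mult_ac)
  finally show "poly_rep X (monomial \<alpha>) z = \<dots>" .
qed

lemma shift_exponents: "\<alpha> \<in> exponents n \<Longrightarrow> \<alpha> i > 0 \<Longrightarrow> shift i j \<alpha> \<in> exponents n"
proof -
  assume \<alpha>: "\<alpha> \<in> exponents n" "\<alpha> i > 0"
  have "(\<Sum>k\<in>UNIV. shift i j \<alpha> k) = (\<Sum>k\<in>UNIV. if k = i then \<alpha> i - 1 else \<alpha> k) + 1"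
    by (simp add: shift_def sum.distrib)
  also have "(\<Sum>k\<in>UNIV. if k = i then \<alpha> i - 1 else \<alpha> k) = (\<alpha> i - 1) + (\<Sum>k\<in>UNIV - {i}. \<alpha> k)"
    by (subst sum.remove[of _ i]) (auto intro!: sum.cong)
  also have "\<dots> + 1 = \<alpha> i + (\<Sum>k\<in>UNIV - {i}. \<alpha> k)" using \<alpha>(2) by simp
  also have "\<dots> = (\<Sum>k\<in>UNIV. \<alpha> k)" by (simp add: sum.remove[of _ i])
  finally show ?thesis using \<alpha>(1) by (simp add: exponents_def)
qed

lemma exponents_le: "\<alpha> \<in> exponents n \<Longrightarrow> \<alpha> i \<le> n"
  unfolding exponents_def by (auto intro: member_le_sum)

lemma finite_exponents: "finite (exponents n :: ('m::finite \<Rightarrow> nat) set)"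
proof (rule finite_subset)
  show "(exponents n :: ('m \<Rightarrow> nat) set) \<subseteq> PiE UNIV (\<lambda>_. {..n})"
    using exponents_le by (auto simp: PiE_def)
qed (intro finite_PiE; simp)

lemma base_expansion_inject:
  fixes f g :: "nat \<Rightarrow> nat"
  assumes "(\<Sum>i<k. f i * b ^ i) = (\<Sum>i<k. g i * b ^ i)"
    and "\<And>i. i < k \<Longrightarrow> f i < b" "\<And>i. i < k \<Longrightarrow> g i < b" and "i < k"
  shows "f i = g i"
  using assms
proof (induction k arbitrary: f g i)
  case (Suc k)
  have split: "(\<Sum>i<Suc k. h i * b ^ i) = h 0 + b * (\<Sum>i<k. h (Suc i) * b ^ i)" for h :: "nat \<Rightarrow> nat"
    by (simp only: sum.lessThan_Suc_shift) (simp add: sum_distrib_left mult_ac)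
  have eq: "f 0 + b * (\<Sum>i<k. f (Suc i) * b ^ i) = g 0 + b * (\<Sum>i<k. g (Suc i) * b ^ i)"
    using Suc.prems(1) unfolding split .
  have fg: "f 0 < b" "g 0 < b" using Suc.prems by auto
  have "f 0 = g 0" using arg_cong[OF eq, of "\<lambda>x. x mod b"] fg by simp
  moreover have "(\<Sum>i<k. f (Suc i) * b ^ i) = (\<Sum>i<k. g (Suc i) * b ^ i)"
    using eq fg calculation by simp
  then have "f (Suc i) = g (Suc i)" if "i < k" for i
    using Suc.IH[of "\<lambda>i. f (Suc i)" "\<lambda>i. g (Suc i)" i] Suc.prems that by simp
  ultimately show ?case using Suc.prems(4) by (cases i) auto
qed simp

text \<open>
  Kronecker's substitution \<open>z_i = T ^ ((n+1) ^ idx i)\<close> turns monomials of degree \<open>n\<close> into pairwise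
  distinct powers of one variable, since exponents at most \<open>n\<close> are digits in base \<open>n+1\<close>.  It reduces
  the claim to polynomials in \<open>T\<close>.
\<close>

lemma monomials_independent:
  fixes a :: "('m::finite \<Rightarrow> nat) \<Rightarrow> complex"
  assumes zero: "\<And>z. (\<Sum>\<alpha>\<in>exponents n. a \<alpha> * monomial \<alpha> z) = 0" and \<beta>: "\<beta> \<in> exponents n"
  shows "a \<beta> = 0"
proof -
  obtain idx :: "'m \<Rightarrow> nat" where idx: "bij_betw idx UNIV {..<CARD('m)}"
    using ex_bij_betw_finite_nat[of "UNIV :: 'm set"] by (auto simp: atLeast0LessThan)
  define \<kappa> where "\<kappa> = (\<lambda>\<alpha> :: 'm \<Rightarrow> nat. \<Sum>i\<in>UNIV. \<alpha> i * Suc n ^ idx i)"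
  have \<kappa>_eq: "\<kappa> \<alpha> = (\<Sum>k<CARD('m). \<alpha> (inv_into UNIV idx k) * Suc n ^ k)" for \<alpha>
    unfolding \<kappa>_def
    using sum.reindex_bij_betw[OF idx, of "\<lambda>k. \<alpha> (inv_into UNIV idx k) * Suc n ^ k"] idx
    by (simp add: bij_betw_def del: power_Suc)
  have inj: "\<alpha> = \<gamma>" if "\<alpha> \<in> exponents n" "\<gamma> \<in> exponents n" "\<kappa> \<alpha> = \<kappa> \<gamma>" for \<alpha> \<gamma>
  proof
    fix i
    have "\<alpha> (inv_into UNIV idx (idx i)) = \<gamma> (inv_into UNIV idx (idx i))"
      using that idx exponents_le[OF that(1)] exponents_le[OF that(2)]
      by (intro base_expansion_inject[of "\<lambda>k. \<alpha> (inv_into UNIV idx k)" "Suc n" "CARD('m)"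
            "\<lambda>k. \<gamma> (inv_into UNIV idx k)" "idx i"])
        (auto simp: \<kappa>_eq less_Suc_eq_le bij_betw_def)
    then show "\<alpha> i = \<gamma> i" using idx by (simp add: bij_betw_def)
  qed
  define p where "p = (\<Sum>\<alpha>\<in>exponents n. monom (a \<alpha>) (\<kappa> \<alpha>))"
  have "poly p T = 0" for T
  proof -
    have "monomial \<alpha> (\<chi> i. T ^ (Suc n ^ idx i)) = T ^ \<kappa> \<alpha>" for \<alpha>
      by (simp add: monomial_def \<kappa>_def power_sum power_mult[symmetric] mult.commute del: power_Suc)
    then show ?thesis
      using zero[of "\<chi> i. T ^ (Suc n ^ idx i)"] by (simp add: p_def poly_sum poly_monom)
  qed
  then have "p = 0" using poly_all_0_iff_0[of p] by blast
  moreover have "coeff p (\<kappa> \<beta>) = (\<Sum>\<alpha>\<in>exponents n. if \<alpha> = \<beta> then a \<alpha> else 0)"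
    unfolding p_def coeff_sum by (intro sum.cong refl) (use inj \<beta> in auto)
  ultimately show ?thesis using \<beta> by (simp add: finite_exponents)
qed

section \<open>A weighted basis of the homogeneous polynomials\<close>

lemma homogeneous_polys_eq:
  "homogeneous_polys n = {P. \<exists>a. P = (\<lambda>z. \<Sum>\<alpha>\<in>exponents n. a \<alpha> * monomial \<alpha> z)}"
  by (simp add: homogeneous_polys_def exponents_def monomial_def)

lemma polynomial_map_homogeneous: "P \<in> homogeneous_polys n \<Longrightarrow> polynomial_map P"
  unfolding homogeneous_polys_eq
  by (auto intro!: polynomial_map_sum polynomial_map.mult polynomial_map.const polynomial_map_monomial)

lemma sum_fun_apply: "(\<Sum>i\<in>I. f i) z = (\<Sum>i\<in>I. f i z)" for f :: "'i \<Rightarrow> 'a \<Rightarrow> 'b::comm_monoid_add"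
  by (induction I rule: infinite_finite_induct) simp_all

text \<open>
  A family without linear relations is injective, so that it is independent as a set as well.
\<close>

lemma independent_imageI:
  fixes e :: "'i \<Rightarrow> 'v::real_vector"
  assumes "finite J" and zero: "\<And>s. (\<Sum>j\<in>J. s j *\<^sub>R e j) = 0 \<Longrightarrow> \<forall>j\<in>J. s j = 0"
  shows "inj_on e J" "independent (e ` J)"
proof -
  show inj: "inj_on e J"
  proof (rule inj_onI, rule ccontr)
    fix j k assume jk: "j \<in> J" "k \<in> J" "e j = e k" "j \<noteq> k"
    have "(\<Sum>i\<in>J. ((if i = j then 1 else 0) - (if i = k then 1 else 0)) *\<^sub>R e i)
        = (\<Sum>i\<in>J. (if i = j then e i else 0) - (if i = k then e i else 0))"
      by (intro sum.cong refl) (simp add: scaleR_diff_left)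
    also have "\<dots> = 0" using jk \<open>finite J\<close> by (simp add: sum_subtractf)
    finally have "\<forall>i\<in>J. (if i = j then 1 else 0) - (if i = k then 1 else 0) = (0::real)" by (rule zero)
    from bspec[OF this jk(1)] jk(4) show False by simp
  qed
  show "independent (e ` J)"
  proof
    assume "dependent (e ` J)"
    then obtain s where s: "\<exists>v\<in>e ` J. s v \<noteq> 0" "(\<Sum>v\<in>e ` J. s v *\<^sub>R v) = 0"
      using \<open>finite J\<close> by (auto simp: dependent_finite)
    then have "(\<Sum>j\<in>J. s (e j) *\<^sub>R e j) = 0" by (simp add: sum.reindex[OF inj])
    from zero[OF this] s(1) show False by auto
  qed
qed

text \<open>
  As a real vector space the homogeneous polynomials need two basis vectors per monomial; the
  Boolean selects the one with the factor \<open>\<i>\<close>.  The weight \<open>w\<close> rescales both.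
\<close>

definition basis_poly :: "(('m::finite \<Rightarrow> nat) \<Rightarrow> real) \<Rightarrow> ('m \<Rightarrow> nat) \<times> bool \<Rightarrow> (complex ^ 'm) \<Rightarrow> complex" where
  "basis_poly w x = (\<lambda>z. of_real (w (fst x)) * (if snd x then \<i> else 1) * monomial (fst x) z)"

definition weighted_basis :: "(('m::finite \<Rightarrow> nat) \<Rightarrow> real) \<Rightarrow> nat \<Rightarrow> ((complex ^ 'm) \<Rightarrow> complex) set" where
  "weighted_basis w n = basis_poly w ` (exponents n \<times> UNIV)"

lemma sum_exponents_bool:
  fixes f :: "('m::finite \<Rightarrow> nat) \<times> bool \<Rightarrow> 'b::comm_monoid_add"
  shows "(\<Sum>x\<in>exponents n \<times> UNIV. f x) = (\<Sum>\<alpha>\<in>exponents n. f (\<alpha>, True) + f (\<alpha>, False))"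
  by (simp add: sum.cartesian_product[symmetric, of "\<lambda>\<alpha> b. f (\<alpha>, b)", simplified] UNIV_bool add.commute)

context
  fixes w :: "('m::finite \<Rightarrow> nat) \<Rightarrow> real"
  assumes w: "\<And>\<alpha>. w \<alpha> > 0"
begin

lemma basis_poly_combination:
  "(\<Sum>x\<in>exponents n \<times> UNIV. s x *\<^sub>R basis_poly w x)
    = (\<lambda>z. \<Sum>\<alpha>\<in>exponents n. (of_real (w \<alpha>) * Complex (s (\<alpha>, False)) (s (\<alpha>, True))) * monomial \<alpha> z)"
  by (rule ext) (simp add: sum_fun_apply sum_exponents_bool scaleR_fun_def basis_poly_def
      scaleR_conv_of_real Complex_eq algebra_simps)

lemma basis_poly_coefficients_zero:
  assumes "(\<Sum>x\<in>exponents n \<times> UNIV. s x *\<^sub>R basis_poly w x) = 0"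
  shows "\<forall>x\<in>exponents n \<times> UNIV. s x = 0"
proof clarify
  fix \<alpha> :: "'m \<Rightarrow> nat" and b assume \<alpha>: "\<alpha> \<in> exponents n"
  have "(\<Sum>\<alpha>\<in>exponents n. (of_real (w \<alpha>) * Complex (s (\<alpha>, False)) (s (\<alpha>, True))) * monomial \<alpha> z) = 0" for z
    using fun_cong[OF assms, of z] unfolding basis_poly_combination by simp
  from monomials_independent[where n = n and a = "\<lambda>\<alpha>. of_real (w \<alpha>) * Complex (s (\<alpha>, False)) (s (\<alpha>, True))", OF this \<alpha>]
  have "Complex (s (\<alpha>, False)) (s (\<alpha>, True)) = 0" using w[of \<alpha>] by simp
  then show "s (\<alpha>, b) = 0" by (cases b) (simp_all add: complex_eq_iff)
qed

lemma inj_basis_poly: "inj_on (basis_poly w) (exponents n \<times> UNIV)"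
  and independent_weighted_basis: "independent (weighted_basis w n)"
  unfolding weighted_basis_def
  using independent_imageI[of "exponents n \<times> UNIV" "basis_poly w", OF _ basis_poly_coefficients_zero]
  by (simp_all add: finite_exponents)

lemma finite_weighted_basis: "finite (weighted_basis w n)"
  by (simp add: weighted_basis_def finite_exponents)

lemma span_weighted_basis: "span (weighted_basis w n) = homogeneous_polys n"
proof
  have "subspace (homogeneous_polys n :: ((complex ^ 'm) \<Rightarrow> complex) set)"
    unfolding subspace_def homogeneous_polys_eq
  proof (intro conjI ballI allI; clarify)
    show "\<exists>a. (0 :: (complex ^ 'm) \<Rightarrow> complex) = (\<lambda>z. \<Sum>\<alpha>\<in>exponents n. a \<alpha> * monomial \<alpha> z)"
      by (intro exI[of _ "\<lambda>_. 0"]) (simp add: fun_eq_iff)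
    show "\<exists>d. (\<lambda>z :: complex ^ 'm. \<Sum>\<alpha>\<in>exponents n. a \<alpha> * monomial \<alpha> z) + (\<lambda>z. \<Sum>\<alpha>\<in>exponents n. b \<alpha> * monomial \<alpha> z)
        = (\<lambda>z. \<Sum>\<alpha>\<in>exponents n. d \<alpha> * monomial \<alpha> z)" for a b
      by (intro exI[of _ "\<lambda>\<alpha>. a \<alpha> + b \<alpha>"]) (simp add: fun_eq_iff distrib_right sum.distrib)
    show "\<exists>d. r *\<^sub>R (\<lambda>z :: complex ^ 'm. \<Sum>\<alpha>\<in>exponents n. a \<alpha> * monomial \<alpha> z)
        = (\<lambda>z. \<Sum>\<alpha>\<in>exponents n. d \<alpha> * monomial \<alpha> z)" for r a
      by (intro exI[of _ "\<lambda>\<alpha>. of_real r * a \<alpha>"])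
        (simp add: fun_eq_iff scaleR_fun_def scaleR_conv_of_real sum_distrib_left mult.assoc)
  qed
  moreover have "basis_poly w (\<beta>, b) \<in> homogeneous_polys n" if "\<beta> \<in> exponents n" for \<beta> b
    unfolding homogeneous_polys_eq mem_Collect_eq
    by (intro exI[of _ "\<lambda>\<alpha>. if \<alpha> = \<beta> then of_real (w \<beta>) * (if b then \<i> else 1) else 0"] ext)
      (simp add: that finite_exponents basis_poly_def if_distrib[of "\<lambda>x. x * _"] cong: if_cong)
  ultimately show "span (weighted_basis w n) \<subseteq> homogeneous_polys n"
    by (intro span_minimal) (auto simp: weighted_basis_def)
  show "homogeneous_polys n \<subseteq> span (weighted_basis w n)"
  proof
    fix P :: "(complex ^ 'm) \<Rightarrow> complex" assume "P \<in> homogeneous_polys n"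
    then obtain a where P: "P = (\<lambda>z. \<Sum>\<alpha>\<in>exponents n. a \<alpha> * monomial \<alpha> z)"
      unfolding homogeneous_polys_eq by blast
    define s where "s = (\<lambda>x. (if snd x then Im (a (fst x)) else Re (a (fst x))) / w (fst x))"
    have "of_real (w \<alpha>) * Complex (s (\<alpha>, False)) (s (\<alpha>, True)) = a \<alpha>" for \<alpha>
      using w[of \<alpha>] by (simp add: s_def complex_eq_iff)
    then have "P = (\<Sum>x\<in>exponents n \<times> UNIV. s x *\<^sub>R basis_poly w x)"
      unfolding basis_poly_combination P by simp
    also have "\<dots> \<in> span (weighted_basis w n)"
      by (intro span_sum span_scale span_base) (auto simp: weighted_basis_def)
    finally show "P \<in> span (weighted_basis w n)" .
  qed
qed

lemma poly_rep_basis_poly: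
  fixes X :: "real^'m^'m"
  shows "poly_rep X (basis_poly w (\<alpha>, b))
    = (\<Sum>i\<in>UNIV. \<Sum>j\<in>UNIV. (- X $ i $ j * real (\<alpha> i) * (w \<alpha> / w (shift i j \<alpha>))) *\<^sub>R basis_poly w (shift i j \<alpha>, b))"
proof
  fix z :: "complex^'m"
  have nz: "w \<beta> \<noteq> 0" for \<beta> using w[of \<beta>] by simp
  have "poly_rep X (basis_poly w (\<alpha>, b)) z = of_real (w \<alpha>) * (if b then \<i> else 1) * poly_rep X (monomial \<alpha>) z"
    unfolding basis_poly_def by (simp add: poly_rep_cmult polynomial_map_monomial)
  also have "\<dots> = (\<Sum>i\<in>UNIV. \<Sum>j\<in>UNIV.
      (- X $ i $ j * real (\<alpha> i) * (w \<alpha> / w (shift i j \<alpha>))) *\<^sub>R basis_poly w (shift i j \<alpha>, b) z)"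
    by (simp add: poly_rep_monomial sum_distrib_left basis_poly_def scaleR_conv_of_real nz mult_ac)
  finally show "poly_rep X (basis_poly w (\<alpha>, b)) z
    = (\<Sum>i\<in>UNIV. \<Sum>j\<in>UNIV. (- X $ i $ j * real (\<alpha> i) * (w \<alpha> / w (shift i j \<alpha>))) *\<^sub>R basis_poly w (shift i j \<alpha>, b)) z"
    by (simp add: sum_fun_apply scaleR_fun_def)
qed

lemma poly_rep_homogeneous:
  fixes X :: "real^'m^'m"
  assumes P: "P \<in> homogeneous_polys n"
  shows "poly_rep X P \<in> homogeneous_polys n"
proof -
  have sub: "subspace (homogeneous_polys n :: ((complex ^ 'm) \<Rightarrow> complex) set)"
    using span_weighted_basis subspace_span by metis
  have base: "poly_rep X (basis_poly w (\<alpha>, b)) \<in> homogeneous_polys n" if "\<alpha> \<in> exponents n" for \<alpha> b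
    unfolding poly_rep_basis_poly
  proof (intro subspace_sum[OF sub])
    fix i j
    have "basis_poly w (shift i j \<alpha>, b) \<in> homogeneous_polys n" if "\<alpha> i > 0"
      using shift_exponents[OF \<open>\<alpha> \<in> exponents n\<close> that, of j] span_weighted_basis[of n]
      by (metis SigmaI UNIV_I imageI span_base weighted_basis_def)
    then have "\<alpha> i \<noteq> 0 \<Longrightarrow> r *\<^sub>R basis_poly w (shift i j \<alpha>, b) \<in> homogeneous_polys n" for r
      by (intro subspace_scale[OF sub]) simp
    then show "(- X $ i $ j * real (\<alpha> i) * (w \<alpha> / w (shift i j \<alpha>))) *\<^sub>R basis_poly w (shift i j \<alpha>, b)
        \<in> homogeneous_polys n"
      using subspace_0[OF sub] by (cases "\<alpha> i = 0") (simp only: of_nat_0 mult_zero_right mult_zero_left scaleR_zero_left, blast)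
  qed
  have "P \<in> span (weighted_basis w n)" using P span_weighted_basis by simp
  then have "P \<in> homogeneous_polys n \<and> poly_rep X P \<in> homogeneous_polys n"
  proof (induction rule: span_induct_alt)
    case base
    have "poly_rep X (0 :: (complex ^ 'm) \<Rightarrow> complex) = 0"
      using poly_rep_const[of X 0] by (simp add: zero_fun_def)
    then show ?case using subspace_0[OF sub] by (simp add: zero_fun_def)
  next
    case (step r u Q)
    have u: "u \<in> homogeneous_polys n" using step(1) span_base span_weighted_basis by blast
    have pu: "poly_rep X u \<in> homogeneous_polys n" using step(1) base by (auto simp: weighted_basis_def)
    have pol: "polynomial_map u" "polynomial_map Q"
      using u step polynomial_map_homogeneous by blast+
    have eq: "poly_rep X (r *\<^sub>R u + Q) = r *\<^sub>R poly_rep X u + poly_rep X Q"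
      using pol poly_rep_add[of "\<lambda>z. of_real r * u z" Q X] poly_rep_cmult[of u X "of_real r"]
      by (simp add: plus_fun_def scaleR_fun_def scaleR_conv_of_real polynomial_map.intros)
    show ?case unfolding eq
      using step by (intro conjI subspace_add[OF sub] subspace_scale[OF sub] u pu) blast+
  qed
  then show ?thesis by simp
qed

lemma coord_poly_rep:
  fixes X :: "real^'m^'m"
  assumes \<alpha>: "\<alpha> \<in> exponents n" and \<beta>: "\<beta> \<in> exponents n"
  shows "representation (weighted_basis w n) (poly_rep X (basis_poly w (\<alpha>, b))) (basis_poly w (\<beta>, b'))
    = (\<Sum>i\<in>UNIV. \<Sum>j\<in>UNIV. if shift i j \<alpha> = \<beta> \<and> b = b' then - X $ i $ j * real (\<alpha> i) * (w \<alpha> / w \<beta>) else 0)"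
proof -
  let ?U = "weighted_basis w n" and ?e = "basis_poly w"
  let ?c = "\<lambda>i j. - X $ i $ j * real (\<alpha> i) * (w \<alpha> / w (shift i j \<alpha>))"
  note ind = independent_weighted_basis[of n]
  have inU: "?e (shift i j \<alpha>, b) \<in> ?U" if "\<alpha> i > 0" for i j
    using shift_exponents[OF \<alpha> that] by (simp add: weighted_basis_def)
  have "\<alpha> i \<noteq> 0 \<Longrightarrow> r *\<^sub>R ?e (shift i j \<alpha>, b) \<in> span ?U" for r i j
    using inU[of i j] by (intro span_scale span_base) simp
  then have summand: "?c i j *\<^sub>R ?e (shift i j \<alpha>, b) \<in> span ?U" for i j
    using span_zero[of ?U] by (cases "\<alpha> i = 0") (simp only: of_nat_0 mult_zero_right mult_zero_left scaleR_zero_left, blast)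
  have rep: "representation ?U (?c i j *\<^sub>R ?e (shift i j \<alpha>, b)) (?e (\<beta>, b'))
      = (if shift i j \<alpha> = \<beta> \<and> b = b' then - X $ i $ j * real (\<alpha> i) * (w \<alpha> / w \<beta>) else 0)" for i j
  proof (cases "\<alpha> i = 0")
    case True
    then show ?thesis by (simp add: representation_zero)
  next
    case False
    then have pos: "\<alpha> i > 0" by simp
    have eq: "?e (\<beta>, b') = ?e (shift i j \<alpha>, b) \<longleftrightarrow> shift i j \<alpha> = \<beta> \<and> b = b'"
      using inj_on_eq_iff[OF inj_basis_poly[of n], of "(\<beta>, b')" "(shift i j \<alpha>, b)"]
        shift_exponents[OF \<alpha> pos] \<beta> by auto
    have "representation ?U (r *\<^sub>R ?e (shift i j \<alpha>, b)) (?e (\<beta>, b'))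
        = r * (if shift i j \<alpha> = \<beta> \<and> b = b' then 1 else 0)" for r
      by (simp only: representation_scale[OF ind span_base[OF inU[OF pos]]]
          representation_basis[OF ind inU[OF pos]] eq)
    then show ?thesis by (simp only:) auto
  qed
  show ?thesis
    unfolding poly_rep_basis_poly
    by (subst representation_sum[OF ind], intro span_sum summand)
      (subst representation_sum[OF ind], rule summand, simp only: rep)
qed

end

section \<open>The extended representation\<close>

text \<open>
  The following facts restate those on polynomial functions with the vector space operations on
  functions in place of pointwise expressions.
\<close>

lemma gl_rep_eq:
  "gl_rep c A P = (c * (trace A / real CARD('m))) *\<^sub>R P
    + poly_rep (A - (trace A / real CARD('m)) *\<^sub>R mat 1) P" for A :: "real^'m^'m"
  by (simp only: gl_rep_def Let_def)

lemma poly_rep_add_vec: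
  assumes "P \<in> homogeneous_polys n" "Q \<in> homogeneous_polys n"
  shows "poly_rep X (P + Q) = poly_rep X P + poly_rep X Q"
  using poly_rep_add[of P Q X] assms polynomial_map_homogeneous by (auto simp: plus_fun_def)

lemma poly_rep_scale_vec:
  assumes "P \<in> homogeneous_polys n"
  shows "poly_rep X (r *\<^sub>R P) = r *\<^sub>R poly_rep X P"
  using poly_rep_cmult[of P X "of_real r"] assms polynomial_map_homogeneous
  by (auto simp: scaleR_fun_def scaleR_conv_of_real)

lemma poly_rep_add_left_vec:
  assumes "P \<in> homogeneous_polys n"
  shows "poly_rep (X + Y) P = poly_rep X P + poly_rep Y P"
  using poly_rep_add_left[of P X Y] assms polynomial_map_homogeneous by (auto simp: plus_fun_def)

lemma poly_rep_scale_left_vec: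
  assumes "P \<in> homogeneous_polys n"
  shows "poly_rep (r *\<^sub>R X) P = r *\<^sub>R poly_rep X P"
  using poly_rep_scale_left[of P r X] assms polynomial_map_homogeneous by (auto simp: scaleR_fun_def)

lemma poly_rep_commutator_vec:
  assumes "P \<in> homogeneous_polys n"
  shows "poly_rep (X ** Y - Y ** X) P = poly_rep X (poly_rep Y P) - poly_rep Y (poly_rep X P)"
  using poly_rep_commutator[of P X Y] assms polynomial_map_homogeneous
  by (auto simp: fun_diff_def)

lemma gl_rep_traceless: "trace A = 0 \<Longrightarrow> gl_rep c A P = poly_rep A P" for A :: "real^'m^'m"
  unfolding gl_rep_eq by (simp add: fun_eq_iff scaleR_fun_def)

lemma gl_module_homogeneous_polys:
  fixes w :: "('m::finite \<Rightarrow> nat) \<Rightarrow> real"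
  assumes w: "\<And>\<alpha>. w \<alpha> > 0"
  shows "gl_module (gl_rep c :: real^'m^'m \<Rightarrow> _) (homogeneous_polys n) (weighted_basis w n) c"
proof -
  let ?W = "homogeneous_polys n :: ((complex ^ 'm) \<Rightarrow> complex) set"
  have sub: "subspace ?W" using span_weighted_basis[OF w] subspace_span by metis
  note W = subspace_add[OF sub] subspace_scale[OF sub] poly_rep_homogeneous[OF w]
  note pr = poly_rep_add_vec poly_rep_scale_vec poly_rep_add_left_vec poly_rep_scale_left_vec
  let ?s = "\<lambda>A :: real^'m^'m. trace A / real CARD('m)"
  let ?A0 = "\<lambda>A :: real^'m^'m. A - ?s A *\<^sub>R mat 1"
  show ?thesis
  proof
    show "finite (weighted_basis w n)" by (rule finite_weighted_basis[OF w])
    show "independent (weighted_basis w n)" by (rule independent_weighted_basis[OF w])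
    show "span (weighted_basis w n) = ?W" by (rule span_weighted_basis[OF w])
    fix A B :: "real^'m^'m" and P Q :: "(complex ^ 'm) \<Rightarrow> complex" and r :: real
    assume P: "P \<in> ?W"
    show "gl_rep c A P \<in> ?W" unfolding gl_rep_eq by (intro W P)
    have s: "?s (A + B) = ?s A + ?s B" "?s (r *\<^sub>R A) = r * ?s A"
      by (simp_all add: trace_add trace_scaleR add_divide_distrib)
    have "?A0 (A + B) = ?A0 A + ?A0 B" unfolding s by (simp add: scaleR_add_left)
    then have "poly_rep (?A0 (A + B)) P = poly_rep (?A0 A) P + poly_rep (?A0 B) P"
      by (simp only: poly_rep_add_left_vec[OF P])
    then show "gl_rep c (A + B) P = gl_rep c A P + gl_rep c B P"
      unfolding gl_rep_eq s(1) distrib_left scaleR_add_left by (simp only: add_ac)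
    have "?A0 (r *\<^sub>R A) = r *\<^sub>R ?A0 A" unfolding s by (simp add: scaleR_diff_right)
    then have "poly_rep (?A0 (r *\<^sub>R A)) P = r *\<^sub>R poly_rep (?A0 A) P"
      by (simp only: poly_rep_scale_left_vec[OF P])
    then show "gl_rep c (r *\<^sub>R A) P = r *\<^sub>R gl_rep c A P"
      unfolding gl_rep_eq s(2) scaleR_add_right scaleR_scaleR by (simp only: mult_ac)
    show "gl_rep c A (r *\<^sub>R P) = r *\<^sub>R gl_rep c A P"
      unfolding gl_rep_eq poly_rep_scale_vec[OF P] scaleR_add_right scaleR_scaleR by (simp only: mult_ac)
    show "gl_rep c A (P + Q) = gl_rep c A P + gl_rep c A Q" if "Q \<in> ?W"
      unfolding gl_rep_eq poly_rep_add_vec[OF P that] scaleR_add_right by (simp only: add_ac)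
    show "gl_rep c (mat 1) P = c *\<^sub>R P"
    proof -
      have "?s (mat 1) = 1" by (simp add: trace_mat_1)
      moreover have "poly_rep (0 :: real^'m^'m) P = 0"
        using poly_rep_scale_left_vec[OF P, of 0 0] by (simp only: scaleR_zero_left)
      ultimately show ?thesis unfolding gl_rep_eq by (simp only: scaleR_one diff_self mult_1_right add_0_right)
    qed
    show "gl_rep c (A ** B - B ** A) P = gl_rep c A (gl_rep c B P) - gl_rep c B (gl_rep c A P)"
    proof -
      have "A ** B - B ** A = ?A0 A ** ?A0 B - ?A0 B ** ?A0 A"
        by (simp add: matrix_mult.diff_left matrix_mult.diff_right matrix_mult.scaleR_left
            matrix_mult.scaleR_right scaleR_diff_right)
      then have lhs: "gl_rep c (A ** B - B ** A) P
          = poly_rep (?A0 A) (poly_rep (?A0 B) P) - poly_rep (?A0 B) (poly_rep (?A0 A) P)"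
        using poly_rep_commutator_vec[OF P, of "?A0 A" "?A0 B"]
        by (simp only: gl_rep_traceless[OF trace_commutator])
      have pP: "poly_rep X P \<in> ?W" for X :: "real^'m^'m" by (intro W P)
      have expand: "gl_rep c A (gl_rep c B P) = (c * ?s A * (c * ?s B)) *\<^sub>R P
          + (c * ?s A) *\<^sub>R poly_rep (?A0 B) P + (c * ?s B) *\<^sub>R poly_rep (?A0 A) P
          + poly_rep (?A0 A) (poly_rep (?A0 B) P)" for A B
      proof -
        have "poly_rep (?A0 A) ((c * ?s B) *\<^sub>R P + poly_rep (?A0 B) P)
            = (c * ?s B) *\<^sub>R poly_rep (?A0 A) P + poly_rep (?A0 A) (poly_rep (?A0 B) P)"
          using poly_rep_add_vec[OF W(2)[OF P] pP] poly_rep_scale_vec[OF P] by (simp only:)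
        then show ?thesis unfolding gl_rep_eq by (simp only: scaleR_add_right scaleR_scaleR add_ac)
      qed
      show ?thesis unfolding lhs expand[of A B] expand[of B A]
        by (simp only: mult_ac) (simp add: fun_eq_iff)
    qed
  qed
qed

text \<open>
  The diagonal entry at \<open>\<alpha>\<close> is \<open>- \<Sum>_i A_ii \<alpha>_i\<close>, whatever the weight.  By symmetry under exchange of
  variables the sum of \<open>\<alpha>_i\<close> over all exponents does not depend on \<open>i\<close>, which leaves a multiple of
  the trace of \<open>A\<close>.
\<close>

lemma trace_poly_rep:
  fixes w :: "('m::finite \<Rightarrow> nat) \<Rightarrow> real" and A :: "real^'m^'m"
  assumes w: "\<And>\<alpha>. w \<alpha> > 0" and tr: "trace A = 0"
  shows "(\<Sum>u\<in>weighted_basis w n. representation (weighted_basis w n) (poly_rep A u) u) = 0"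
proof -
  let ?E = "exponents n :: ('m \<Rightarrow> nat) set"
  have nz: "w \<alpha> \<noteq> 0" for \<alpha> using w[of \<alpha>] by simp
  have diag: "representation (weighted_basis w n) (poly_rep A (basis_poly w (\<alpha>, b))) (basis_poly w (\<alpha>, b))
      = (\<Sum>i\<in>UNIV. - A $ i $ i * real (\<alpha> i))" if "\<alpha> \<in> ?E" for \<alpha> b
  proof -
    have "(\<Sum>j\<in>UNIV. if shift i j \<alpha> = \<alpha> \<and> b = b then - A $ i $ j * real (\<alpha> i) * (w \<alpha> / w \<alpha>) else 0)
        = (\<Sum>j\<in>UNIV. if j = i then - A $ i $ i * real (\<alpha> i) else 0)" for i
    proof (intro sum.cong refl)
      fix j
      show "(if shift i j \<alpha> = \<alpha> \<and> b = b then - A $ i $ j * real (\<alpha> i) * (w \<alpha> / w \<alpha>) else 0)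
          = (if j = i then - A $ i $ i * real (\<alpha> i) else 0)"
      proof (cases "\<alpha> i = 0")
        case False
        have "shift i j \<alpha> = \<alpha> \<longleftrightarrow> j = i"
        proof
          assume "shift i j \<alpha> = \<alpha>"
          from fun_cong[OF this, of i] show "j = i" using False by (auto simp: shift_def split: if_splits)
        qed (use False in \<open>auto simp: shift_def fun_eq_iff\<close>)
        then show ?thesis by (auto simp: nz)
      qed simp
    qed
    then show ?thesis unfolding coord_poly_rep[OF w that that] by simp
  qed
  have same: "(\<Sum>\<alpha>\<in>?E. real (\<alpha> i)) = (\<Sum>\<alpha>\<in>?E. real (\<alpha> j))" for i j
  proof (rule sum.reindex_bij_witness[of _ "\<lambda>\<alpha>. \<alpha> \<circ> Transposition.transpose i j" "\<lambda>\<alpha>. \<alpha> \<circ> Transposition.transpose i j"])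
    have perm: "(\<Sum>k\<in>UNIV. \<alpha> (Transposition.transpose i j k)) = (\<Sum>k\<in>UNIV. \<alpha> k)" for \<alpha> :: "'m \<Rightarrow> nat"
      by (rule sum.reindex_bij_betw) simp
    show "\<alpha> \<circ> Transposition.transpose i j \<in> ?E" if "\<alpha> \<in> ?E" for \<alpha>
      using that perm[of \<alpha>] by (simp add: exponents_def)
    then show "\<alpha> \<circ> Transposition.transpose i j \<in> ?E" if "\<alpha> \<in> ?E" for \<alpha> using that .
  qed (simp_all add: fun_eq_iff)
  obtain k :: real where k: "\<And>i. (\<Sum>\<alpha>\<in>?E. real (\<alpha> i)) = k"
    using same by metis
  have "(\<Sum>u\<in>weighted_basis w n. representation (weighted_basis w n) (poly_rep A u) u)
      = (\<Sum>x\<in>?E \<times> (UNIV :: bool set). \<Sum>i\<in>UNIV. - A $ i $ i * real (fst x i))"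
    unfolding weighted_basis_def sum.reindex[OF inj_basis_poly[OF w]]
    unfolding weighted_basis_def[symmetric]
    by (intro sum.cong refl) (auto simp: diag)
  also have "\<dots> = 2 * (\<Sum>\<alpha>\<in>?E. \<Sum>i\<in>UNIV. - A $ i $ i * real (\<alpha> i))"
    by (simp add: sum_exponents_bool sum_distrib_left)
  also have "(\<Sum>\<alpha>\<in>?E. \<Sum>i\<in>UNIV. - A $ i $ i * real (\<alpha> i)) = (\<Sum>i\<in>UNIV. - A $ i $ i * (\<Sum>\<alpha>\<in>?E. real (\<alpha> i)))"
    by (subst sum.swap) (simp add: sum_distrib_left)
  also have "\<dots> = - k * trace A" by (simp add: k trace_def sum_distrib_left mult.commute)
  finally show ?thesis using tr by simp
qed

text \<open>
  Completing the square in \<open>y\<close> leaves \<open>x\<^sup>2\<close> with a coefficient that grows like \<open>s\<^sup>2\<close>, while the mixed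
  coefficient \<open>2 m + n / 2\<close> stays bounded.
\<close>

lemma quadratic_form_pos:
  fixes m n s x y :: real
  assumes "m \<ge> 1" "n \<ge> 1" "s \<ge> 4 * (m + n)" and xy: "x \<noteq> 0 \<or> y \<noteq> 0"
  shows "0 < m / 2 * (x\<^sup>2 + y\<^sup>2) + 2 * m * x * y + (1/4) * (n * s * x + y / s)\<^sup>2"
proof -
  have "0 < 4 * (m + n)" using assms(1,2) by simp
  then have s: "s > 0" using assms(3) by (rule less_le_trans)
  define k where "k = (2 * m + n / 2) / m"
  have "4 * (m + n) * 1 \<le> s * n" using assms(1-3) s by (intro mult_mono) auto
  then have "(4 * (m + n))\<^sup>2 \<le> (s * n)\<^sup>2" using assms(1-3) by (intro power_mono) auto
  then have ns: "4 * (m + n)\<^sup>2 \<le> n\<^sup>2 * s\<^sup>2 / 4"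
    unfolding power_mult_distrib by (simp add: mult.commute)
  have "m * k\<^sup>2 / 2 < 4 * (m + n)\<^sup>2"
  proof -
    have "m * k\<^sup>2 / 2 = (2 * m + n / 2)\<^sup>2 / (2 * m)" using assms(1-3) by (simp add: k_def power2_eq_square)
    also have "\<dots> \<le> (2 * m + n / 2)\<^sup>2 / 1" using assms(1-3) by (intro divide_left_mono) auto
    also have "\<dots> < (2 * (m + n))\<^sup>2 / 1" using assms(1-3) by (simp add: power_strict_mono)
    finally show ?thesis unfolding power_mult_distrib by simp
  qed
  then have coef: "0 < m / 2 + n\<^sup>2 * s\<^sup>2 / 4 - m * k\<^sup>2 / 2" using ns assms(1) by linarith
  have "m / 2 * (x\<^sup>2 + y\<^sup>2) + 2 * m * x * y + (1/4) * (n * s * x + y / s)\<^sup>2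
      = m / 2 * (y + k * x)\<^sup>2 + (m / 2 + n\<^sup>2 * s\<^sup>2 / 4 - m * k\<^sup>2 / 2) * x\<^sup>2 + (1/4) * (y / s)\<^sup>2"
    using s assms(1) by (simp add: k_def field_simps power2_eq_square)
  moreover have "0 < m / 2 * (y + k * x)\<^sup>2 + (m / 2 + n\<^sup>2 * s\<^sup>2 / 4 - m * k\<^sup>2 / 2) * x\<^sup>2"
  proof (cases "x = 0")
    case True
    then show ?thesis using xy assms(1) by simp
  next
    case False
    then have "0 < (m / 2 + n\<^sup>2 * s\<^sup>2 / 4 - m * k\<^sup>2 / 2) * x\<^sup>2" using coef by simp
    moreover have "0 \<le> m / 2 * (y + k * x)\<^sup>2" using assms(1) by simp
    ultimately show ?thesis by linarith
  qed
  moreover have "0 \<le> (1/4) * (y / s)\<^sup>2" by simp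
  ultimately show ?thesis by linarith
qed

section \<open>Positivity for strongly rescaled monomials\<close>

definition pure_power :: "nat \<Rightarrow> 'm \<Rightarrow> 'm \<Rightarrow> nat" where
  "pure_power n i = (\<lambda>k. if k = i then n else 0)"

lemma pure_power_exponents: "pure_power n i \<in> exponents n"
  by (simp add: exponents_def pure_power_def)

lemma sum_double_delta:
  "(\<Sum>k\<in>UNIV. \<Sum>l\<in>UNIV. if k = i then if l = j then x else 0 else 0) = x"
  for i :: "'a::finite" and j :: "'b::finite" and x :: "'c::comm_monoid_add"
proof -
  have "(\<Sum>l\<in>UNIV. if k = i then if l = j then x else 0 else 0) = (if k = i then x else 0)" for k
    by simp
  then show ?thesis by simp
qed

context
  fixes w :: "('m::finite \<Rightarrow> nat) \<Rightarrow> real" and A :: "real^'m^'m" and n :: nat and i j :: 'm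
  assumes w: "\<And>\<alpha>. w \<alpha> > 0" and n: "n > 0" and ij: "i \<noteq> j"
begin

lemma neighbour_exponents: "shift i j (pure_power n i) \<in> exponents n"
  using n by (intro shift_exponents pure_power_exponents) (simp add: pure_power_def)

text \<open>
  From \<open>z_i ^ n\<close> the only way to reach \<open>z_i ^ (n-1) * z_j\<close> in one step is through \<open>A_ij\<close>, and by the next
  lemma the only way back is through \<open>A_ji\<close>.
\<close>

lemma coord_pure_to_neighbour:
  "representation (weighted_basis w n) (poly_rep A (basis_poly w (pure_power n i, b)))
      (basis_poly w (shift i j (pure_power n i), b))
    = - A $ i $ j * real n * (w (pure_power n i) / w (shift i j (pure_power n i)))"
  (is "?lhs = ?rhs")
proof -
  have "(if shift k l (pure_power n i) = shift i j (pure_power n i) \<and> b = b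
        then - A $ k $ l * real (pure_power n i k) * (w (pure_power n i) / w (shift i j (pure_power n i))) else 0)
      = (if k = i then if l = j then ?rhs else 0 else 0)" for k l
  proof (cases "k = i \<and> l \<noteq> j")
    case True
    then have "shift k l (pure_power n i) \<noteq> shift i j (pure_power n i)"
      by (auto simp: shift_def fun_eq_iff intro!: exI[of _ j])
    then show ?thesis using True by simp
  qed (auto simp: pure_power_def)
  then show ?thesis
    unfolding coord_poly_rep[OF w pure_power_exponents neighbour_exponents] by (simp only: sum_double_delta)
qed

lemma coord_neighbour_to_pure:
  "representation (weighted_basis w n) (poly_rep A (basis_poly w (shift i j (pure_power n i), b)))
      (basis_poly w (pure_power n i, b))
    = - A $ j $ i * (w (shift i j (pure_power n i)) / w (pure_power n i))"
  (is "?lhs = ?rhs")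
proof -
  let ?\<beta> = "shift i j (pure_power n i)"
  have \<beta>: "?\<beta> k = (if k = i then n - 1 else if k = j then 1 else 0)" for k
    using ij by (auto simp: shift_def pure_power_def)
  have "(if shift k l ?\<beta> = pure_power n i \<and> b = b
        then - A $ k $ l * real (?\<beta> k) * (w ?\<beta> / w (pure_power n i)) else 0)
      = (if k = j then if l = i then ?rhs else 0 else 0)" for k l
  proof -
    consider "k = j" "l = i" | "k = j" "l \<noteq> i" | "k = i" | "k \<noteq> i" "k \<noteq> j" by blast
    then show ?thesis
    proof cases
      case 1
      then have "shift k l ?\<beta> = pure_power n i"
        using n ij by (auto simp: shift_def pure_power_def fun_eq_iff)
      then show ?thesis using 1 ij by (simp add: \<beta>)
    next
      case 2
      then have "shift k l ?\<beta> i \<noteq> pure_power n i i"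
        using n ij by (simp add: shift_def pure_power_def)
      then have "shift k l ?\<beta> \<noteq> pure_power n i" by metis
      then show ?thesis using 2 by simp
    next
      case 3
      then have "shift k l ?\<beta> j \<noteq> pure_power n i j"
        using n ij by (simp add: shift_def pure_power_def)
      then have "shift k l ?\<beta> \<noteq> pure_power n i" by metis
      then show ?thesis using 3 ij by simp
    next
      case 4
      then show ?thesis by (simp add: \<beta>)
    qed
  qed
  then show ?thesis
    unfolding coord_poly_rep[OF w neighbour_exponents pure_power_exponents] by (simp only: sum_double_delta)
qed

end

text \<open>
  The factor by which the diagonal matrix with entries \<open>t ^ (- idx k)\<close> scales the monomial \<open>z\<^sup>\<alpha>\<close>.
\<close>

definition diagonal_weight :: "('m::finite \<Rightarrow> nat) \<Rightarrow> real \<Rightarrow> ('m \<Rightarrow> nat) \<Rightarrow> real" where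
  "diagonal_weight idx t \<alpha> = (1 / t) ^ (\<Sum>k\<in>UNIV. idx k * \<alpha> k)"

lemma diagonal_weight_ratio:
  assumes t: "t > 0" and n: "n > 0" and lt: "idx i < idx j"
  shows "diagonal_weight idx t (pure_power n i) / diagonal_weight idx t (shift i j (pure_power n i))
    = t ^ (idx j - idx i)"
proof -
  have ij: "i \<noteq> j" using lt by auto
  have top: "(\<Sum>k\<in>UNIV. idx k * pure_power n i k) = idx i * n"
    by (simp add: pure_power_def if_distrib[of "\<lambda>x. _ * x"] cong: if_cong)
  have "(\<Sum>k\<in>UNIV. idx k * shift i j (pure_power n i) k)
      = (\<Sum>k\<in>UNIV. (if k = i then idx i * (n - 1) else 0) + (if k = j then idx j else 0))"
    using ij by (intro sum.cong refl) (auto simp: shift_def pure_power_def)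
  also have "\<dots> = idx i * (n - 1) + idx j" by (simp add: sum.distrib)
  also have "\<dots> = idx i * n + (idx j - idx i)"
    using lt n by (cases n) (simp_all add: algebra_simps)
  finally have neighbour: "(\<Sum>k\<in>UNIV. idx k * shift i j (pure_power n i) k) = idx i * n + (idx j - idx i)" .
  show ?thesis unfolding diagonal_weight_def top neighbour
    using t by (simp add: power_add power_one_over)
qed

text \<open>
  All squares in the double sum may be dropped except, for each pair of variables with
  \<open>idx i < idx j\<close>, the one belonging to \<open>z_i ^ n\<close> and \<open>z_i ^ (n-1) * z_j\<close>.  What remains splits into the
  quadratic forms of \<open>quadratic_form_pos\<close> in the pairs of entries
  \<open>(A_ij, A_ji)\<close>, with \<open>s\<close> a positive power of the base of the weight, and into positive multiples
  of the squares of the diagonal entries.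
\<close>

lemma ricci_form_positive:
  fixes A :: "real^'m^'m" and idx :: "'m \<Rightarrow> nat"
  assumes n: "n > 0" and idx: "inj idx" and A: "A \<noteq> 0"
  defines "w \<equiv> diagonal_weight idx (4 * (real CARD('m) + real n))"
  shows "0 < real CARD('m) / 2 * (A \<bullet> A) + real CARD('m) * trace (A ** A)
    + (1/4) * (\<Sum>u\<in>weighted_basis w n. \<Sum>v\<in>weighted_basis w n.
        (representation (weighted_basis w n) (poly_rep A u) v
          + representation (weighted_basis w n) (poly_rep A v) u)\<^sup>2)"
proof -
  let ?m = "real CARD('m)" and ?U = "weighted_basis w n"
  define t where "t = 4 * (?m + real n)"
  have m: "?m \<ge> 1" and n1: "real n \<ge> 1" using n by (simp_all add: Suc_le_eq)
  have "4 * 1 \<le> t" unfolding t_def using m n1 by (intro mult_mono) auto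
  then have t: "t \<ge> 1" by simp
  have w_def': "w = diagonal_weight idx t" by (simp add: w_def t_def)
  have w: "w \<alpha> > 0" for \<alpha> using t by (simp add: w_def' diagonal_weight_def)
  define s where "s = (\<lambda>i j. t ^ (idx j - idx i))"
  define g where "g = (\<lambda>u v. (representation ?U (poly_rep A u) v + representation ?U (poly_rep A v) u)\<^sup>2)"
  define \<phi> where "\<phi> = (\<lambda>(i, j). (basis_poly w (pure_power n i, False), basis_poly w (shift i j (pure_power n i), False)))"
  define Lt where "Lt = {(i, j). idx i < idx j}"
  have g_pair: "(case \<phi> (i, j) of (u, v) \<Rightarrow> g u v) = (real n * s i j * A $ i $ j + A $ j $ i / s i j)\<^sup>2"
    if lt: "idx i < idx j" for i j
  proof -
    have ij: "i \<noteq> j" using lt by auto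
    have ratio: "w (pure_power n i) / w (shift i j (pure_power n i)) = s i j"
      unfolding w_def' s_def using diagonal_weight_ratio[OF _ n lt, of t] t by simp
    then have ratio': "w (shift i j (pure_power n i)) / w (pure_power n i) = 1 / s i j"
      by (metis inverse_divide inverse_eq_divide)
    have "(case \<phi> (i, j) of (u, v) \<Rightarrow> g u v) = (- (real n * s i j * A $ i $ j + A $ j $ i / s i j))\<^sup>2"
      unfolding \<phi>_def g_def split coord_pure_to_neighbour[OF w n ij] coord_neighbour_to_pure[OF w n ij]
        ratio ratio'
      by (rule arg_cong[of _ _ "\<lambda>x. x\<^sup>2"]) simp
    then show ?thesis unfolding power2_minus .
  qed
  have "shift i j (pure_power n i) \<in> exponents n" if "idx i < idx j" for i j
    using that by (intro neighbour_exponents[OF w n]) auto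
  then have \<phi>_U: "\<phi> ` Lt \<subseteq> ?U \<times> ?U"
    using pure_power_exponents by (auto simp: \<phi>_def Lt_def weighted_basis_def intro!: imageI)
  have \<phi>_inj: "inj_on \<phi> Lt"
  proof (rule inj_onI, clarify)
    fix i j k l assume *: "(i, j) \<in> Lt" "(k, l) \<in> Lt" "\<phi> (i, j) = \<phi> (k, l)"
    then have ij: "i \<noteq> j" and kl: "k \<noteq> l" by (auto simp: Lt_def)
    have eqs: "basis_poly w (pure_power n i, False) = basis_poly w (pure_power n k, False)"
      "basis_poly w (shift i j (pure_power n i), False) = basis_poly w (shift k l (pure_power n k), False)"
      using *(3) by (simp_all only: \<phi>_def split prod.inject)
    have "pure_power n i = pure_power n k"
      using inj_onD[OF inj_basis_poly[OF w, where n = n] eqs(1)] by (simp add: pure_power_exponents)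
    from fun_cong[OF this, of i] have ik: "i = k" using n by (auto simp: pure_power_def split: if_splits)
    have "shift i j (pure_power n i) = shift k l (pure_power n k)"
      using inj_onD[OF inj_basis_poly[OF w, where n = n] eqs(2)] neighbour_exponents[OF w n ij]
        neighbour_exponents[OF w n kl] by simp
    from fun_cong[OF this, of j] have "j = l" using ik by (auto simp: shift_def split: if_splits)
    then show "i = k \<and> j = l" using ik by simp
  qed
  have "(\<Sum>p\<in>Lt. case \<phi> p of (u, v) \<Rightarrow> g u v) = (\<Sum>(u, v)\<in>\<phi> ` Lt. g u v)"
    by (simp add: sum.reindex[OF \<phi>_inj])
  also have "\<dots> \<le> (\<Sum>(u, v)\<in>?U \<times> ?U. g u v)"
    using \<phi>_U finite_weighted_basis[of w n, OF w] by (intro sum_mono2) (auto simp: g_def)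
  finally have bound: "(\<Sum>p\<in>Lt. case \<phi> p of (u, v) \<Rightarrow> g u v) \<le> (\<Sum>u\<in>?U. \<Sum>v\<in>?U. g u v)"
    by (simp add: sum.cartesian_product)
  define q where "q = (\<lambda>i j. if idx i < idx j
      then (1/4) * (real n * s i j * A $ i $ j + A $ j $ i / s i j)\<^sup>2 else 0)"
  have q_sum: "(\<Sum>i\<in>UNIV. \<Sum>j\<in>UNIV. q i j) = (1/4) * (\<Sum>p\<in>Lt. case \<phi> p of (u, v) \<Rightarrow> g u v)"
  proof -
    have "(1/4) * (\<Sum>p\<in>Lt. case \<phi> p of (u, v) \<Rightarrow> g u v) = (\<Sum>p\<in>Lt. q (fst p) (snd p))"
      unfolding sum_distrib_left by (intro sum.cong refl) (auto simp: Lt_def q_def g_pair)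
    also have "\<dots> = (\<Sum>p\<in>UNIV \<times> UNIV. q (fst p) (snd p))"
      by (intro sum.mono_neutral_left) (auto simp: Lt_def q_def)
    finally show ?thesis by (simp add: sum.cartesian_product case_prod_beta)
  qed
  \<comment> \<open>The entries \<open>(i, j)\<close> and \<open>(j, i)\<close> are only positive together: \<open>q\<close> is supported on one of them.\<close>
  define h where "h = (\<lambda>i j. ?m / 2 * (A $ i $ j)\<^sup>2 + ?m * (A $ i $ j * A $ j $ i) + q i j)"
  have h_pos: "h i j + h j i > 0" if nz: "A $ i $ j \<noteq> 0 \<or> A $ j $ i \<noteq> 0" for i j
  proof -
    have off: "h i j + h j i > 0" if lt: "idx i < idx j" and nz: "A $ i $ j \<noteq> 0 \<or> A $ j $ i \<noteq> 0" for i j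
    proof -
      have "t ^ 1 \<le> s i j" unfolding s_def using lt t by (intro power_increasing) auto
      then have "4 * (?m + real n) \<le> s i j" by (simp add: t_def)
      from quadratic_form_pos[OF m n1 this nz] show ?thesis
        using lt by (simp add: h_def q_def power2_eq_square algebra_simps)
    qed
    consider "idx i < idx j" | "idx j < idx i" | "i = j" using idx by (metis injD linorder_neqE_nat)
    then show ?thesis
    proof cases
      case 1
      then show ?thesis using off nz by blast
    next
      case 2
      then have "h j i + h i j > 0" using off nz by blast
      then show ?thesis by (simp add: add.commute)
    next
      case 3
      then have "h i j + h j i = 3 * ?m * (A $ i $ i)\<^sup>2"
        by (simp add: h_def q_def power2_eq_square)
      then show ?thesis using nz 3 m by simp
    qed
  qed
  have h_nonneg: "h i j + h j i \<ge> 0" for i j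
  proof (cases "A $ i $ j \<noteq> 0 \<or> A $ j $ i \<noteq> 0")
    case True
    then show ?thesis using h_pos by (simp add: less_imp_le)
  qed (simp add: h_def q_def)
  obtain k l where kl: "A $ k $ l \<noteq> 0" using A by (auto simp: vec_eq_iff)
  have "0 < (\<Sum>p\<in>UNIV \<times> UNIV. h (fst p) (snd p) + h (snd p) (fst p))"
    using h_pos[of k l] kl h_nonneg by (intro sum_pos2[of _ "(k, l)"]) auto
  also have "\<dots> = (\<Sum>i\<in>UNIV. \<Sum>j\<in>UNIV. h i j) + (\<Sum>i\<in>UNIV. \<Sum>j\<in>UNIV. h j i)"
    by (simp add: sum.distrib[symmetric] sum.cartesian_product case_prod_beta)
  also have "(\<Sum>i\<in>UNIV. \<Sum>j\<in>UNIV. h j i) = (\<Sum>i\<in>UNIV. \<Sum>j\<in>UNIV. h i j)" by (rule sum.swap)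
  finally have pos: "0 < (\<Sum>i\<in>UNIV. \<Sum>j\<in>UNIV. h i j)" by simp
  have inner: "A \<bullet> A = (\<Sum>i\<in>UNIV. \<Sum>j\<in>UNIV. (A $ i $ j)\<^sup>2)"
    by (simp add: inner_vec_def power2_eq_square)
  have trace: "trace (A ** A) = (\<Sum>i\<in>UNIV. \<Sum>j\<in>UNIV. A $ i $ j * A $ j $ i)"
    by (simp add: trace_def matrix_matrix_mult_def)
  have "(\<Sum>i\<in>UNIV. \<Sum>j\<in>UNIV. h i j) = ?m / 2 * (A \<bullet> A) + ?m * trace (A ** A) + (\<Sum>i\<in>UNIV. \<Sum>j\<in>UNIV. q i j)"
    unfolding h_def inner trace sum_distrib_left by (simp only: sum.distrib)
  also have "(\<Sum>i\<in>UNIV. \<Sum>j\<in>UNIV. q i j) \<le> (1/4) * (\<Sum>u\<in>?U. \<Sum>v\<in>?U. g u v)"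
    unfolding q_sum using bound by simp
  finally show ?thesis using pos unfolding g_def by simp
qed

theorem proposition4p7:
  fixes n :: nat and c :: real
  assumes "CARD('m::finite) \<ge> 2" and "n \<ge> 2" and "c \<noteq> 0"
  shows "admits_negative_ricci
    ((UNIV :: (real ^ 'm ^ 'm) set) \<times> (homogeneous_polys n :: ((complex ^ 'm) \<Rightarrow> complex) set))
    (gl_semidirect_bracket (gl_rep c))"
proof -
  obtain idx :: "'m \<Rightarrow> nat" where idx: "inj idx"
    using finite_imp_inj_to_nat_seg[of "UNIV :: 'm set"] by auto
  define w where "w = diagonal_weight idx (4 * (real CARD('m) + real n))"
  have w: "w \<alpha> > 0" for \<alpha>
    using assms(2) by (simp add: w_def diagonal_weight_def)
  interpret gl_module "gl_rep c :: real^'m^'m \<Rightarrow> _" "homogeneous_polys n" "weighted_basis w n" c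
    by (rule gl_module_homogeneous_polys[OF w])
  show ?thesis
  proof (rule admits_negative_ricci_semidirect)
    show "c \<noteq> 0" by fact
    show "weighted_basis w n \<noteq> {}"
      using pure_power_exponents by (auto simp: weighted_basis_def)
    fix A :: "real^'m^'m" assume tr: "trace A = 0"
    show "(\<Sum>u\<in>weighted_basis w n. coord u (gl_rep c A u)) = 0"
      unfolding gl_rep_traceless[OF tr] by (rule trace_poly_rep[OF w tr])
    assume "A \<noteq> 0"
    then show "0 < real CARD('m) / 2 * (A \<bullet> A) + real CARD('m) * trace (A ** A)
        + (1/4) * (\<Sum>u\<in>weighted_basis w n. \<Sum>v\<in>weighted_basis w n.
            (coord v (gl_rep c A u) + coord u (gl_rep c A v))\<^sup>2)"
      unfolding gl_rep_traceless[OF tr] w_def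
      using assms(2) idx by (intro ricci_form_positive) auto
  qed
qed

end
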